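(* Let $\mathcal{R} = (\mathcal{F}, R)$ be a TRS over a finite many-sorted signature $\mathcal{F} = (S,\Omega)$ and let $\Pi$ be a finite set of forbidden patterns all of the form $\langle u, o, h\rangle$ with $u$ linear. For all ground terms $s,t \in \mathcal{T}(\mathcal{F})$ we have $s \rightarrow_{\mathcal{R},\Pi}^+ t$ if and only if $\mathsf{top}(s) \rightarrow_{T(\mathcal{R},\Pi)}^+ \mathsf{top}(t)$, where $\mathsf{top}$ is $\mathsf{top}_{sort(s)}$.
   Context: Forbidden-pattern rewriting: for $\Pi$ a finite set of triples $\langle u, o, h\rangle$ ($u$ a term, $o\in Pos(u)$), $s \rightarrow_{\mathcal{R},\Pi} t$ iff $s \xrightarrow{p}_{\mathcal{R}} t$ for some $p\in Pos_{\mathcal{F}}(s)$ and there is no $\langle u,o,h\rangle\in\Pi$, context $C$, position $q'$, substitution $\sigma$ with $s = C[u\sigma]_{q'}$ and $p = q'.o$. For each sort $s\in S$ let $\mathsf{top}_s$ be a fresh unary symbol of type $s\rightarrow s$. A positioned rule is a pair $\langle l\rightarrow r, p\rangle$ (rule plus position). Define $RV_\Pi(l,p) = \{x\in Var(l) \mid \exists \langle u,o,h\rangle\in\Pi, q: \theta = mgu(u, l|_q)$ exists, $q.o = p$, $x\theta\notin V\}$. $T^i(\langle l\rightarrow r,p\rangle)$ is the set of all $\langle l\sigma\rightarrow r\sigma, p\rangle$ where $x\in RV_\Pi(l,p)$, $f\in\mathcal{F}$ with result sort $sort(x)$, $x\sigma = f(x_1,\dots,x_{ar(f)})$ with fresh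 variables and $y\sigma = y$ for $y\neq x$. $T^e(\langle l\rightarrow r,p\rangle)$ is the set of all $\langle C[l]\rightarrow C[r], i.p\rangle$ where $C = f(x_1,\dots,x_{i-1},\Box,x_{i+1},\dots,x_{ar(f)})$ (fresh variables) with $f \in \mathcal{F}\uplus\{\mathsf{top}_s\mid s\in S\}$ whose $i$-th argument sort is $sort(l)$, provided there exist $\langle u,o,h\rangle\in\Pi$, a position $q\neq\epsilon$ and $\theta$ with $u|_q\theta = l\theta$ and $o = q.p$. Let $T(\rho) = T^i(\rho)\uplus T^e(\rho)$. A positioned rule $\langle l\rightarrow r,p\rangle$ is $\Pi$-stable if there is no context $C$, substitution $\sigma$, positions $q,q'$, pattern $\langle u,o,h\rangle\in\Pi$ and $\theta$ with $C[l\sigma]_q|_{q'} = u\theta$ and $q.p = q'.o$; it is $\Pi$-obsolete if there are $\langle u,o,h\rangle\in\Pi$, $q$, $\theta$ with $l|_q = u\theta$ and $p = q.o$. The transformation: (1) $R^{tmp} = \{\langle l\rightarrow r,\epsilon\rangle\mid l\rightarrow r\in R\}$, $R^{acc}=\emptyset$; (2) add to $R^{acc}$ the $\Pi$-stable rules of $R^{tmp}$ and set $R^{tmp}$ to the rules of $R^{tmp}$ that are neither $\Pi$-stable nor $\Pi$-obsolete; (3) $R^{tmp} = \bigcup_{\rho\in R^{tmp}} T(\rho)$; (4) if $R^{tmp}\neq\emptyset$ go to (2); (5) $T(\mathcal{R},\Pi) = (\mathcal{F}\uplus\{\mathsf{top}_s\mid s\in S\}, \{l\rightarrow r\mid \langle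 l\rightarrow r,p\rangle\in R^{acc}\})$. *)

theory Defs
  imports "HOL-Library.While_Combinator"
begin

datatype (funs_trm: 'f, vars_trm: 'v) trm = Var 'v | Fun 'f "('f, 'v) trm list"

datatype ('f, 'v) ctxt = Hole | More 'f "('f, 'v) trm list" "('f, 'v) ctxt" "('f, 'v) trm list"

type_synonym pos = "nat list"

fun subst_apply :: "('f, 'v) trm \<Rightarrow> ('v \<Rightarrow> ('f, 'w) trm) \<Rightarrow> ('f, 'w) trm" (infixl "\<cdot>" 67) where
  "Var x \<cdot> \<sigma> = \<sigma> x"
| "Fun f ts \<cdot> \<sigma> = Fun f (map (\<lambda>t. t \<cdot> \<sigma>) ts)"

fun ctxt_apply :: "('f, 'v) ctxt \<Rightarrow> ('f, 'v) trm \<Rightarrow> ('f, 'v) trm" ("_\<langle>_\<rangle>" [1000, 0] 1000) where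
  "Hole\<langle>t\<rangle> = t"
| "(More f ss C ts)\<langle>t\<rangle> = Fun f (ss @ C\<langle>t\<rangle> # ts)"

text \<open>Argument positions are counted from 0.\<close>

fun hole_pos :: "('f, 'v) ctxt \<Rightarrow> pos" where
  "hole_pos Hole = []"
| "hole_pos (More f ss C ts) = length ss # hole_pos C"

lemma size_nth_less [termination_simp]:
  "i < length ts \<Longrightarrow> size (ts ! i) < Suc (size_list size ts)"
  by (metis less_Suc_eq_le nth_mem order_refl size_list_estimation')

fun poss :: "('f, 'v) trm \<Rightarrow> pos set" where
  "poss (Var x) = {[]}"
| "poss (Fun f ts) = insert [] (\<Union>i\<in>{..<length ts}. (#) i ` poss (ts ! i))"

text \<open>Only meaningful for positions of the term.\<close>

fun subt_at :: "('f, 'v) trm \<Rightarrow> pos \<Rightarrow> ('f, 'v) trm" (infixl "|'_" 67) where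
  "t |_ [] = t"
| "Fun f ts |_ (i # p) = (ts ! i) |_ p"
| "Var x |_ (i # p) = undefined"

definition fun_poss :: "('f, 'v) trm \<Rightarrow> pos set" where
  "fun_poss t = {p \<in> poss t. t |_ p \<notin> range Var}"

definition ground :: "('f, 'v) trm \<Rightarrow> bool" where
  "ground t \<longleftrightarrow> vars_trm t = {}"

definition linear_trm :: "('f, 'v) trm \<Rightarrow> bool" where
  "linear_trm t \<longleftrightarrow>
     (\<forall>p\<in>poss t. \<forall>q\<in>poss t. \<forall>x. t |_ p = Var x \<and> t |_ q = Var x \<longrightarrow> p = q)"

text \<open>
  Many-sorted terms. The set of sorts is the type \<open>'s\<close>; a signature assigns to each of its
  symbols the list of argument sorts and the result sort. The variable \<open>(n, s)\<close> has sort \<open>s\<close>,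
  so every sort has countably many variables.
\<close>

type_synonym ('f, 's) signature = "'f \<rightharpoonup> 's list \<times> 's"
type_synonym 's var = "nat \<times> 's"
type_synonym ('f, 's) sterm = "('f, 's var) trm"
type_synonym ('f, 's) sctxt = "('f, 's var) ctxt"
type_synonym ('f, 's) subst = "'s var \<Rightarrow> ('f, 's) sterm"
type_synonym ('f, 's) rule = "('f, 's) sterm \<times> ('f, 's) sterm"
type_synonym ('f, 's) trs = "('f, 's) signature \<times> ('f, 's) rule set"

inductive has_sort :: "('f, 's) signature \<Rightarrow> ('f, 's) sterm \<Rightarrow> 's \<Rightarrow> bool" for \<Omega> where
  "has_sort \<Omega> (Var (n, s)) s"
| "\<Omega> f = Some (ss, s) \<Longrightarrow> list_all2 (has_sort \<Omega>) ts ss \<Longrightarrow> has_sort \<Omega> (Fun f ts) s"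

definition sorted_subst :: "('f, 's) signature \<Rightarrow> ('f, 's) subst \<Rightarrow> bool" where
  "sorted_subst \<Omega> \<sigma> \<longleftrightarrow> (\<forall>n s. has_sort \<Omega> (\<sigma> (n, s)) s)"

definition is_trs :: "('f, 's) trs \<Rightarrow> bool" where
  "is_trs = (\<lambda>(\<Omega>, R). \<forall>(l, r)\<in>R.
     (\<exists>s. has_sort \<Omega> l s \<and> has_sort \<Omega> r s) \<and> l \<notin> range Var \<and> vars_trm r \<subseteq> vars_trm l)"

definition rstep_at ::
  "('f, 's) trs \<Rightarrow> pos \<Rightarrow> ('f, 's) sterm \<Rightarrow> ('f, 's) sterm \<Rightarrow> bool" where
  "rstep_at = (\<lambda>(\<Omega>, R) p s t. \<exists>(l, r)\<in>R. \<exists>C \<sigma>.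
     sorted_subst \<Omega> \<sigma> \<and> hole_pos C = p \<and> s = C\<langle>l \<cdot> \<sigma>\<rangle> \<and> t = C\<langle>r \<cdot> \<sigma>\<rangle>)"

definition rstep :: "('f, 's) trs \<Rightarrow> ('f, 's) sterm \<Rightarrow> ('f, 's) sterm \<Rightarrow> bool" where
  "rstep \<R> s t \<longleftrightarrow> (\<exists>p. rstep_at \<R> p s t)"

text \<open>
  Forbidden patterns \<open>\<langle>u, o, h\<rangle>\<close>. The notions below only concern patterns whose third
  component is \<open>h\<close> (here); patterns of the other kinds (above, below) play no role.
\<close>

datatype scope = Here | Above | Below

type_synonym ('f, 's) pattern = "('f, 's) sterm \<times> pos \<times> scope"

definition is_pattern :: "('f, 's) signature \<Rightarrow> ('f, 's) pattern \<Rightarrow> bool" where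
  "is_pattern \<Omega> = (\<lambda>(u, k, h). (\<exists>s. has_sort \<Omega> u s) \<and> k \<in> poss u)"

definition fp_step ::
  "('f, 's) trs \<Rightarrow> ('f, 's) pattern set \<Rightarrow> ('f, 's) sterm \<Rightarrow> ('f, 's) sterm \<Rightarrow> bool" where
  "fp_step \<R> \<Pi> s t \<longleftrightarrow> (\<exists>p\<in>fun_poss s. rstep_at \<R> p s t \<and>
     \<not> (\<exists>u k C q' \<sigma>. (u, k, Here) \<in> \<Pi> \<and> sorted_subst (fst \<R>) \<sigma> \<and>
          hole_pos C = q' \<and> s = C\<langle>u \<cdot> \<sigma>\<rangle> \<and> p = q' @ k))"

definition top_ext :: "('s \<Rightarrow> 'f) \<Rightarrow> ('f, 's) signature \<Rightarrow> ('f, 's) signature" where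
  "top_ext tp \<Omega> = (\<lambda>f. if f \<in> range tp then Some ([inv tp f], inv tp f) else \<Omega> f)"

definition is_mgu ::
  "('f, 's) signature \<Rightarrow> ('f, 's) subst \<Rightarrow> ('f, 's) sterm \<Rightarrow> ('f, 's) sterm \<Rightarrow> bool" where
  "is_mgu \<Omega> \<theta> s t \<longleftrightarrow> sorted_subst \<Omega> \<theta> \<and> s \<cdot> \<theta> = t \<cdot> \<theta> \<and>
     (\<forall>\<delta>. sorted_subst \<Omega> \<delta> \<and> s \<cdot> \<delta> = t \<cdot> \<delta> \<longrightarrow>
        (\<exists>\<tau>. sorted_subst \<Omega> \<tau> \<and> (\<forall>x. \<delta> x = \<theta> x \<cdot> \<tau>)))"

text \<open>
  Whenever a pattern is unified with (a subterm of) a left-hand side, the pattern is first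
  renamed apart: \<open>u'\<close> is a variant of \<open>u\<close> sharing no variable with \<open>l\<close>.
\<close>

definition variant_apart :: "('f, 's) sterm \<Rightarrow> ('f, 's) sterm \<Rightarrow> ('f, 's) sterm \<Rightarrow> bool" where
  "variant_apart l u u' \<longleftrightarrow>
     (\<exists>\<rho>. inj \<rho> \<and> (\<forall>x. snd (\<rho> x) = snd x) \<and> u' = u \<cdot> (\<lambda>x. Var (\<rho> x))) \<and>
     vars_trm u' \<inter> vars_trm l = {}"

type_synonym ('f, 's) prule = "('f, 's) rule \<times> pos"

text \<open>
  The signature parameter of \<open>RV\<close>, \<open>stable\<close> and \<open>obsolete\<close> is the one extended by the
  \<open>top\<close> symbols, since the positioned rules live there.
\<close>

definition RV ::
  "('f, 's) signature \<Rightarrow> ('f, 's) pattern set \<Rightarrow> ('f, 's) sterm \<Rightarrow> pos \<Rightarrow> 's var set" where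
  "RV \<Omega> \<Pi> l p = {x \<in> vars_trm l. \<exists>u k u' q \<theta>. (u, k, Here) \<in> \<Pi> \<and> variant_apart l u u' \<and>
     q \<in> poss l \<and> is_mgu \<Omega> \<theta> u' (l |_ q) \<and> q @ k = p \<and> \<theta> x \<notin> range Var}"

text \<open>
  In \<open>T_inst\<close> and \<open>T_ext\<close> all choices of fresh variables are admitted, so the resulting sets
  contain all variants of the respective rules.
\<close>

definition T_inst ::
  "('s \<Rightarrow> 'f) \<Rightarrow> ('f, 's) signature \<Rightarrow> ('f, 's) pattern set \<Rightarrow> ('f, 's) prule \<Rightarrow> ('f, 's) prule set"
  where
  "T_inst tp \<Omega> \<Pi> = (\<lambda>((l, r), p).
     {((l \<cdot> \<sigma>, r \<cdot> \<sigma>), p) | \<sigma> x f ss xs.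
        x \<in> RV (top_ext tp \<Omega>) \<Pi> l p \<and> \<Omega> f = Some (ss, snd x) \<and>
        map snd xs = ss \<and> distinct xs \<and> set xs \<inter> (vars_trm l \<union> vars_trm r) = {} \<and>
        \<sigma> = Var(x := Fun f (map Var xs))})"

definition T_ext ::
  "('s \<Rightarrow> 'f) \<Rightarrow> ('f, 's) signature \<Rightarrow> ('f, 's) pattern set \<Rightarrow> ('f, 's) prule \<Rightarrow> ('f, 's) prule set"
  where
  "T_ext tp \<Omega> \<Pi> = (\<lambda>((l, r), p).
     {((C\<langle>l\<rangle>, C\<langle>r\<rangle>), i # p) | C i f a s xs ys.
        has_sort (top_ext tp \<Omega>) l a \<and>
        top_ext tp \<Omega> f = Some (map snd xs @ a # map snd ys, s) \<and> i = length xs \<and>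
        distinct (xs @ ys) \<and> set (xs @ ys) \<inter> (vars_trm l \<union> vars_trm r) = {} \<and>
        C = More f (map Var xs) Hole (map Var ys) \<and>
        (\<exists>u k u' q \<theta>. (u, k, Here) \<in> \<Pi> \<and> variant_apart l u u' \<and> q \<in> poss u' \<and> q \<noteq> [] \<and>
           sorted_subst (top_ext tp \<Omega>) \<theta> \<and> (u' |_ q) \<cdot> \<theta> = l \<cdot> \<theta> \<and> k = q @ p)})"

definition T_step ::
  "('s \<Rightarrow> 'f) \<Rightarrow> ('f, 's) signature \<Rightarrow> ('f, 's) pattern set \<Rightarrow> ('f, 's) prule \<Rightarrow> ('f, 's) prule set"
  where
  "T_step tp \<Omega> \<Pi> \<rho> = T_inst tp \<Omega> \<Pi> \<rho> \<union> T_ext tp \<Omega> \<Pi> \<rho>"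

definition stable :: "('f, 's) signature \<Rightarrow> ('f, 's) pattern set \<Rightarrow> ('f, 's) prule \<Rightarrow> bool" where
  "stable \<Omega> \<Pi> = (\<lambda>((l, r), p).
     \<not> (\<exists>C \<sigma> q q' u k \<theta>. (u, k, Here) \<in> \<Pi> \<and> sorted_subst \<Omega> \<sigma> \<and> sorted_subst \<Omega> \<theta> \<and>
          (\<exists>s. has_sort \<Omega> (C\<langle>l \<cdot> \<sigma>\<rangle>) s) \<and> hole_pos C = q \<and> q' \<in> poss (C\<langle>l \<cdot> \<sigma>\<rangle>) \<and>
          C\<langle>l \<cdot> \<sigma>\<rangle> |_ q' = u \<cdot> \<theta> \<and> q @ p = q' @ k))"

definition obsolete :: "('f, 's) signature \<Rightarrow> ('f, 's) pattern set \<Rightarrow> ('f, 's) prule \<Rightarrow> bool" where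
  "obsolete \<Omega> \<Pi> = (\<lambda>((l, r), p).
     \<exists>u k q \<theta>. (u, k, Here) \<in> \<Pi> \<and> sorted_subst \<Omega> \<theta> \<and>
       q \<in> poss l \<and> l |_ q = u \<cdot> \<theta> \<and> p = q @ k)"

text \<open>
  The transformation loop on pairs of sets of positioned rules \<open>(R_tmp, R_acc)\<close>. Testing the
  exit condition before rather than after the body makes no difference, since the body maps
  \<open>({}, A)\<close> to itself. The value is meaningful only if the loop terminates.
\<close>

definition transform_loop ::
  "('s \<Rightarrow> 'f) \<Rightarrow> ('f, 's) trs \<Rightarrow> ('f, 's) pattern set \<Rightarrow> ('f, 's) prule set \<times> ('f, 's) prule set"
  where
  "transform_loop tp = (\<lambda>(\<Omega>, R) \<Pi>.
     let \<Omega>' = top_ext tp \<Omega> in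
     while (\<lambda>(R_tmp, R_acc). R_tmp \<noteq> {})
       (\<lambda>(R_tmp, R_acc).
          (\<Union>\<rho>\<in>{\<rho> \<in> R_tmp. \<not> stable \<Omega>' \<Pi> \<rho> \<and> \<not> obsolete \<Omega>' \<Pi> \<rho>}. T_step tp \<Omega> \<Pi> \<rho>,
           R_acc \<union> {\<rho> \<in> R_tmp. stable \<Omega>' \<Pi> \<rho>}))
       ((\<lambda>lr. (lr, [])) ` R, {}))"

definition transform :: "('s \<Rightarrow> 'f) \<Rightarrow> ('f, 's) trs \<Rightarrow> ('f, 's) pattern set \<Rightarrow> ('f, 's) trs" where
  "transform tp \<R> \<Pi> = (top_ext tp (fst \<R>), fst ` snd (transform_loop tp \<R> \<Pi>))"

end

theory Submission
  imports Defs
begin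

text \<open>
  Fix a ground term and an allowed redex in it. The loop starts with a rule matching at that redex,
  and as long as this rule is not stable, one of its successors still matches around the same
  position: if the pattern sticks out above the left-hand side, the actual context supplies the
  symbol of an extension; if the pattern matches inside an instance of the left-hand side, then, the pattern
  being linear and the rule not obsolete, the mgu instantiates some variable, for which the actual
  matching substitution supplies the symbol. The successor is never obsolete, since the redex
  would then be forbidden. As the loop terminates, a stable rule for the redex is accepted.
  Conversely, an accepted rule is a rule of \<open>R\<close> put into a context and instantiated, and its
  stability says that no pattern forbids the step. The symbol \<open>top\<close> marks the root, where there is
  no further context to extend into.
\<close>

text \<open>Linearity makes the variable choice of \<open>RV\<close> sufficient. For the non-linear
  pattern \<open>f(x,x)\<close> and the left-hand side \<open>f(y,z)\<close> the mgu merely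
  identifies \<open>y\<close> and \<open>z\<close>: the rule is no instance of the pattern, yet no
  variable receives a symbol, so instantiation could not refine it. For a linear pattern, a unifier
  mapping the variables of the subterm to variables already yields a match. The same view of
  variable positions bounds the depth of instantiation. The other obstacle is the pair of
  signatures. The rules produced by the loop and the substitutions in the stability test live over
  \<open>\<Omega>'\<close>, whereas forbidden steps are defined by matches over
  \<open>\<Omega>\<close>. Passing from one to the other means reading the sorts of bindings off a
  sorted instance and resetting the substitution to the identity on all other variables.\<close>

section \<open>Terms, positions and sorts\<close>

lemma subst_subst: "t \<cdot> \<sigma> \<cdot> \<tau> = t \<cdot> (\<lambda>x. \<sigma> x \<cdot> \<tau>)"
  by (induction t) auto

lemma subst_cong: "(\<And>x. x \<in> vars_trm t \<Longrightarrow> \<sigma> x = \<tau> x) \<Longrightarrow> t \<cdot> \<sigma> = t \<cdot> \<tau>"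
  by (induction t) auto

lemma subst_Var [simp]: "t \<cdot> Var = t"
  by (induction t) (auto intro: map_idI)

lemma vars_subst: "vars_trm (t \<cdot> \<sigma>) = (\<Union>x\<in>vars_trm t. vars_trm (\<sigma> x))"
  by (induction t) auto

lemma vars_subst_Var: "vars_trm (t \<cdot> (\<lambda>x. Var (\<rho> x))) = \<rho> ` vars_trm t"
  by (auto simp: vars_subst)

lemma funs_subst: "x \<in> vars_trm t \<Longrightarrow> funs_trm (\<sigma> x) \<subseteq> funs_trm (t \<cdot> \<sigma>)"
  by (induction t) auto

lemma finite_vars [simp]: "finite (vars_trm t)"
  by (induction t) auto

lemma Nil_in_poss [simp]: "[] \<in> poss t"
  by (cases t) auto

lemma finite_poss [simp]: "finite (poss t)"
  by (induction t) auto

lemma poss_append: "p @ q \<in> poss t \<longleftrightarrow> p \<in> poss t \<and> q \<in> poss (t |_ p)"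
proof (induction p arbitrary: t)
  case (Cons i p)
  then show ?case by (cases t) auto
qed simp

lemma subt_at_append: "p \<in> poss t \<Longrightarrow> t |_ (p @ q) = t |_ p |_ q"
proof (induction p arbitrary: t)
  case (Cons i p)
  then show ?case by (cases t) auto
qed simp

lemma subt_at_subst:
  "p \<in> poss t \<Longrightarrow> p \<in> poss (t \<cdot> \<sigma>) \<and> (t \<cdot> \<sigma>) |_ p = (t |_ p) \<cdot> \<sigma>"
proof (induction p arbitrary: t)
  case (Cons i p)
  then show ?case by (cases t) auto
qed simp

lemma vars_subt_at: "p \<in> poss t \<Longrightarrow> vars_trm (t |_ p) \<subseteq> vars_trm t"
proof (induction p arbitrary: t)
  case (Cons i p)
  then obtain f ts where t: "t = Fun f ts" "i < length ts" "p \<in> poss (ts ! i)"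
    by (cases t) auto
  with Cons.IH[of "ts ! i"] show ?case by (auto intro!: bexI[OF _ nth_mem])
qed simp

lemma vars_trm_pos: "x \<in> vars_trm t \<Longrightarrow> \<exists>p\<in>poss t. t |_ p = Var x"
proof (induction t)
  case (Fun f ts)
  then obtain i where i: "i < length ts" "x \<in> vars_trm (ts ! i)"
    by (auto simp: in_set_conv_nth)
  then obtain p where "p \<in> poss (ts ! i)" "ts ! i |_ p = Var x"
    using Fun.IH[OF nth_mem[OF i(1)]] by blast
  with i show ?case by (intro bexI[of _ "i # p"]) auto
qed simp

section \<open>Contexts\<close>

lemma hole_pos_poss: "hole_pos C @ q \<in> poss C\<langle>t\<rangle> \<longleftrightarrow> q \<in> poss t"
  by (induction C) (auto simp: nth_append)

lemma hole_pos_subt_at: "C\<langle>t\<rangle> |_ (hole_pos C @ q) = t |_ q"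
  by (induction C) (auto simp: nth_append)

lemma ctxt_of_pos: "p \<in> poss t \<Longrightarrow> \<exists>C. t = C\<langle>t |_ p\<rangle> \<and> hole_pos C = p"
proof (induction p arbitrary: t)
  case Nil
  show ?case by (intro exI[of _ Hole]) simp
next
  case (Cons i p)
  then obtain f ts where t: "t = Fun f ts" "i < length ts" "p \<in> poss (ts ! i)"
    by (cases t) auto
  with Cons.IH obtain C where C: "ts ! i = C\<langle>ts ! i |_ p\<rangle>" "hole_pos C = p" by blast
  show ?case
    using t C by (intro exI[of _ "More f (take i ts) C (drop (Suc i) ts)"])
      (simp add: id_take_nth_drop[symmetric])
qed

text \<open>Stands in for applying a substitution to a context. A single \<open>D\<close> serves
  every filling, so both sides of a rewrite step are carried along together.\<close>

lemma ctxt_subst: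
  "\<exists>D. hole_pos D = hole_pos C \<and> (\<forall>t. C\<langle>t\<rangle> \<cdot> \<sigma> = D\<langle>t \<cdot> \<sigma>\<rangle>)"
proof (induction C)
  case Hole
  show ?case by (intro exI[of _ Hole]) simp
next
  case (More f ss C ts)
  then obtain D where "hole_pos D = hole_pos C" "\<forall>t. C\<langle>t\<rangle> \<cdot> \<sigma> = D\<langle>t \<cdot> \<sigma>\<rangle>" by blast
  then show ?case
    by (intro exI[of _ "More f (map (\<lambda>t. t \<cdot> \<sigma>) ss) D (map (\<lambda>t. t \<cdot> \<sigma>) ts)"]) simp
qed

lemma ctxt_comp:
  "\<exists>E. hole_pos E = hole_pos C @ hole_pos D \<and> (\<forall>t. C\<langle>D\<langle>t\<rangle>\<rangle> = E\<langle>t\<rangle>)"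
proof (induction C)
  case Hole
  show ?case by (intro exI[of _ D]) simp
next
  case (More f ss C ts)
  then obtain E where "hole_pos E = hole_pos C @ hole_pos D" "\<forall>t. C\<langle>D\<langle>t\<rangle>\<rangle> = E\<langle>t\<rangle>" by blast
  then show ?case by (intro exI[of _ "More f ss E ts"]) simp
qed

text \<open>\<open>More\<close> exposes the outermost layer, but an extension adds the symbol
  directly above the left-hand side; hence this view from the hole.\<close>

lemma ctxt_split_last:
  "C \<noteq> Hole \<Longrightarrow> \<exists>D f ss ts. hole_pos C = hole_pos D @ [length ss] \<and>
     (\<forall>t. C\<langle>t\<rangle> = D\<langle>Fun f (ss @ t # ts)\<rangle>)"
proof (induction C)
  case (More f ss C ts)
  show ?case
  proof (cases "C = Hole")
    case True
    then show ?thesis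
      by (intro exI[of _ Hole] exI[of _ f] exI[of _ ss] exI[of _ ts]) simp
  next
    case False
    with More.IH obtain D g us vs where
      "hole_pos C = hole_pos D @ [length us]" "\<forall>t. C\<langle>t\<rangle> = D\<langle>Fun g (us @ t # vs)\<rangle>" by blast
    then show ?thesis
      by (intro exI[of _ "More f ss D ts"] exI[of _ g] exI[of _ us] exI[of _ vs]) simp
  qed
qed simp

lemma vars_ctxt: "\<exists>V. \<forall>t. vars_trm C\<langle>t\<rangle> = V \<union> vars_trm t"
proof (induction C)
  case (More f ss C ts)
  then obtain V where "\<forall>t. vars_trm C\<langle>t\<rangle> = V \<union> vars_trm t" by blast
  then show ?case
    by (intro exI[of _ "V \<union> \<Union>(vars_trm ` set ss) \<union> \<Union>(vars_trm ` set ts)"]) auto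
qed auto

lemma funs_ctxt: "funs_trm t \<subseteq> funs_trm C\<langle>t\<rangle>"
  by (induction C) auto

section \<open>Sorts under substitution and replacement\<close>

lemma has_sort_Var [simp]: "has_sort \<Omega> (Var x) s \<longleftrightarrow> s = snd x"
  by (cases x) (auto elim: has_sort.cases intro: has_sort.intros)

lemma has_sort_Fun:
  "has_sort \<Omega> (Fun f ts) s \<longleftrightarrow> (\<exists>ss. \<Omega> f = Some (ss, s) \<and> list_all2 (has_sort \<Omega>) ts ss)"
  by (auto elim: has_sort.cases intro: has_sort.intros)

lemma has_sort_unique: "has_sort \<Omega> t s \<Longrightarrow> has_sort \<Omega> t s' \<Longrightarrow> s = s'"
  by (cases t) (auto simp: has_sort_Fun)

lemma sorted_substD: "sorted_subst \<Omega> \<sigma> \<Longrightarrow> has_sort \<Omega> (\<sigma> x) (snd x)"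
  by (cases x) (auto simp: sorted_subst_def)

lemma sorted_substI: "(\<And>x. has_sort \<Omega> (\<sigma> x) (snd x)) \<Longrightarrow> sorted_subst \<Omega> \<sigma>"
  unfolding sorted_subst_def by (metis snd_conv)

lemma has_sort_subst:
  "has_sort \<Omega> t s \<Longrightarrow> sorted_subst \<Omega> \<sigma> \<Longrightarrow> has_sort \<Omega> (t \<cdot> \<sigma>) s"
proof (induction t arbitrary: s)
  case (Fun f ts)
  from Fun.prems(1) obtain ss where ss: "\<Omega> f = Some (ss, s)" "list_all2 (has_sort \<Omega>) ts ss"
    by (auto simp: has_sort_Fun)
  have "list_all2 (has_sort \<Omega>) (map (\<lambda>t. t \<cdot> \<sigma>) ts) ss"
    using ss(2) Fun.IH Fun.prems(2) by (auto simp: list_all2_conv_all_nth)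
  with ss(1) show ?case by (simp add: has_sort_Fun)
qed (auto simp: sorted_substD)

lemma sorted_subst_comp:
  "sorted_subst \<Omega> \<sigma> \<Longrightarrow> sorted_subst \<Omega> \<tau> \<Longrightarrow> sorted_subst \<Omega> (\<lambda>x. \<sigma> x \<cdot> \<tau>)"
  by (rule sorted_substI) (simp add: has_sort_subst sorted_substD)

text \<open>Converse direction to \<open>has_sort_subst\<close>: the declarations on the path to an
  occurrence of \<open>x\<close> fix the sort of \<open>\<sigma> x\<close>. The instance may live in
  a larger signature, as instances over \<open>\<Omega>'\<close> of patterns over
  \<open>\<Omega>\<close> do.\<close>

lemma has_sort_subst_vars:
  "has_sort \<Omega> t s \<Longrightarrow> has_sort \<Omega>' (t \<cdot> \<sigma>) s \<Longrightarrow> (\<And>f. f \<in> dom \<Omega> \<Longrightarrow> \<Omega>' f = \<Omega> f) \<Longrightarrow>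
     x \<in> vars_trm t \<Longrightarrow> has_sort \<Omega>' (\<sigma> x) (snd x)"
proof (induction t arbitrary: s)
  case (Fun f ts)
  from Fun.prems(1) obtain ss where ss: "\<Omega> f = Some (ss, s)" "list_all2 (has_sort \<Omega>) ts ss"
    by (auto simp: has_sort_Fun)
  with Fun.prems(3)[of f] have "\<Omega>' f = Some (ss, s)" by auto
  with Fun.prems(2) have l: "list_all2 (has_sort \<Omega>') (map (\<lambda>t. t \<cdot> \<sigma>) ts) ss"
    by (auto simp: has_sort_Fun)
  from Fun.prems(4) obtain i where i: "i < length ts" "x \<in> vars_trm (ts ! i)"
    by (auto simp: in_set_conv_nth)
  show ?case
    using Fun.IH[OF nth_mem[OF i(1)], of "ss ! i"] i ss l Fun.prems(3)
    by (auto simp: list_all2_conv_all_nth)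
qed simp

lemma has_sort_subt_at: "has_sort \<Omega> t s \<Longrightarrow> p \<in> poss t \<Longrightarrow> \<exists>s'. has_sort \<Omega> (t |_ p) s'"
proof (induction p arbitrary: t s)
  case (Cons i p)
  then obtain f ts where t: "t = Fun f ts" "i < length ts" "p \<in> poss (ts ! i)"
    by (cases t) auto
  with Cons.prems have "\<exists>s'. has_sort \<Omega> (ts ! i) s'"
    by (auto simp: has_sort_Fun list_all2_conv_all_nth)
  with Cons.IH t show ?case by auto
qed auto

lemma has_sort_ctxt_hole: "has_sort \<Omega> C\<langle>t\<rangle> s \<Longrightarrow> \<exists>s'. has_sort \<Omega> t s'"
  using has_sort_subt_at[of \<Omega> "C\<langle>t\<rangle>" s "hole_pos C"] hole_pos_poss[of C "[]" t]
    hole_pos_subt_at[of C t "[]"] by simp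

lemma has_sort_ctxt_replace:
  "has_sort \<Omega> C\<langle>t\<rangle> s \<Longrightarrow> has_sort \<Omega> t a \<Longrightarrow> has_sort \<Omega> t' a \<Longrightarrow> has_sort \<Omega> C\<langle>t'\<rangle> s"
proof (induction C arbitrary: s)
  case Hole
  then show ?case using has_sort_unique by fastforce
next
  case (More f ss C ts)
  from More.prems(1) obtain as b bs where
    "\<Omega> f = Some (as @ b # bs, s)" "list_all2 (has_sort \<Omega>) ss as" "has_sort \<Omega> C\<langle>t\<rangle> b"
    "list_all2 (has_sort \<Omega>) ts bs"
    by (auto simp: has_sort_Fun list_all2_append1 list_all2_Cons1)
  with More.IH[of b] More.prems show ?case
    by (auto simp: has_sort_Fun intro!: list_all2_appendI)
qed

lemma has_sort_funs: "has_sort \<Omega> t s \<Longrightarrow> funs_trm t \<subseteq> dom \<Omega>"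
proof (induction t arbitrary: s)
  case (Fun f ts)
  from Fun.prems obtain ss where ss: "\<Omega> f = Some (ss, s)" "list_all2 (has_sort \<Omega>) ts ss"
    by (auto simp: has_sort_Fun)
  have "funs_trm t \<subseteq> dom \<Omega>" if "t \<in> set ts" for t
    using that ss(2) Fun.IH[OF that] by (metis in_set_conv_nth list_all2_nthD)
  with ss(1) show ?case by auto
qed simp

lemma has_sort_extend:
  "has_sort \<Omega> t s \<Longrightarrow> (\<And>f. f \<in> dom \<Omega> \<Longrightarrow> \<Omega>' f = \<Omega> f) \<Longrightarrow> has_sort \<Omega>' t s"
proof (induction t arbitrary: s)
  case (Fun f ts)
  from Fun.prems(1) obtain ss where ss: "\<Omega> f = Some (ss, s)" "list_all2 (has_sort \<Omega>) ts ss"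
    by (auto simp: has_sort_Fun)
  with Fun.prems(2)[of f] have "\<Omega>' f = Some (ss, s)" by auto
  moreover have "list_all2 (has_sort \<Omega>') ts ss"
    using ss(2) Fun.IH Fun.prems(2) by (auto simp: list_all2_conv_all_nth)
  ultimately show ?case by (simp add: has_sort_Fun)
qed simp

lemma sorted_subst_Var: "sorted_subst \<Omega> Var"
  by (simp add: sorted_subst_def)

lemma sorted_subst_restrict:
  assumes "has_sort \<Omega> t s" "has_sort \<Omega>' (t \<cdot> \<sigma>) s" "\<And>f. f \<in> dom \<Omega> \<Longrightarrow> \<Omega>' f = \<Omega> f"
  shows "sorted_subst \<Omega>' (\<lambda>x. if x \<in> vars_trm t then \<sigma> x else Var x)"
  using has_sort_subst_vars[OF assms] by (auto intro!: sorted_substI)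

section \<open>Unification and linear patterns\<close>

definition unifies :: "('v \<Rightarrow> ('f, 'w) trm) \<Rightarrow> (('f, 'v) trm \<times> ('f, 'v) trm) list \<Rightarrow> bool" where
  "unifies \<delta> E \<longleftrightarrow> (\<forall>(s, t)\<in>set E. s \<cdot> \<delta> = t \<cdot> \<delta>)"

definition well_sorted_eqs ::
  "('f, 's) signature \<Rightarrow> (('f, 's) sterm \<times> ('f, 's) sterm) list \<Rightarrow> bool" where
  "well_sorted_eqs \<Omega> E \<longleftrightarrow> (\<forall>(s, t)\<in>set E. \<exists>a. has_sort \<Omega> s a \<and> has_sort \<Omega> t a)"

abbreviation vars_eqs :: "(('f, 'v) trm \<times> ('f, 'v) trm) list \<Rightarrow> 'v set" where
  "vars_eqs E \<equiv> (\<Union>(s, t)\<in>set E. vars_trm s \<union> vars_trm t)"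

lemma size_le_subst_var: "x \<in> vars_trm t \<Longrightarrow> size (\<sigma> x) \<le> size (t \<cdot> \<sigma>)"
proof (induction t)
  case (Fun f ts)
  then obtain t where t: "t \<in> set ts" "x \<in> vars_trm t" by auto
  with Fun have "size (\<sigma> x) \<le> size (t \<cdot> \<sigma>)" by blast
  also have "\<dots> \<le> size_list size (map (\<lambda>t. t \<cdot> \<sigma>) ts)"
    using t(1) by (intro size_list_estimation'[of "t \<cdot> \<sigma>"]) auto
  finally show ?case by simp
qed simp

text \<open>A proper occurrence of \<open>x\<close> in \<open>t\<close> would make
  \<open>\<sigma> x\<close> strictly larger than itself.\<close>

lemma occurs_check:
  assumes "\<sigma> x = t \<cdot> \<sigma>" "x \<in> vars_trm t"
  shows "t = Var x"
proof (cases t)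
  case (Fun f ts)
  with assms(2) obtain t' where t': "t' \<in> set ts" "x \<in> vars_trm t'" by auto
  then have "size (\<sigma> x) \<le> size (t' \<cdot> \<sigma>)" by (simp add: size_le_subst_var)
  also have "\<dots> \<le> size_list size (map (\<lambda>t. t \<cdot> \<sigma>) ts)"
    using t'(1) by (intro size_list_estimation'[of "t' \<cdot> \<sigma>"]) auto
  finally show ?thesis using assms(1) Fun by simp
qed (use assms in simp)

lemma subst_upd_absorb: "\<delta> x = t \<cdot> \<delta> \<Longrightarrow> s \<cdot> (Var(x := t)) \<cdot> \<delta> = s \<cdot> \<delta>"
  by (simp add: subst_subst, rule subst_cong) simp

text \<open>The mgu absorbs every unifier on the left: this idempotent form of most generality is
  what the elimination of a variable propagates.\<close>

lemma mgu_eqs_exists: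
  "well_sorted_eqs \<Omega> E \<Longrightarrow> unifies \<delta>0 E \<Longrightarrow>
   \<exists>\<theta>. sorted_subst \<Omega> \<theta> \<and> unifies \<theta> E \<and>
     (\<forall>\<delta> :: ('f, 's) subst. unifies \<delta> E \<longrightarrow> (\<forall>x. \<delta> x = \<theta> x \<cdot> \<delta>))"
  for \<delta>0 :: "('f, 's) subst"
\<comment> \<open>Eliminating a variable lowers the first component of this lexicographic measure.
  Decomposition and deletion introduce no variables and are handled by the later components.\<close>
proof (induction E rule: wf_induct_rule[OF wf_measures[of
    "[\<lambda>E. card (vars_eqs E), \<lambda>E. \<Sum>(s, t)\<leftarrow>E. size s + size t, length]"]])
  case (1 E)
  have fin: "finite (vars_eqs E)" for E :: "(('f, 's) sterm \<times> ('f, 's) sterm) list" by auto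
  \<comment> \<open>One elimination argument for both orientations of an equation;
    \<open>unifies\<close> depends only on the set of equations.\<close>
  have elim: ?case if E: "set E = insert (Var x, t) (set E') \<or> set E = insert (t, Var x) (set E')"
    and ne: "t \<noteq> Var x" for x t E'
  proof -
    have eq: "\<delta> x = t \<cdot> \<delta>" "unifies \<delta> E'" if "unifies \<delta> E" for \<delta> :: "('f, 's) subst"
      using that E by (auto simp: unifies_def)
    have nx: "x \<notin> vars_trm t" using occurs_check[of \<delta>0 x t] eq 1(3) ne by blast
    have sx: "has_sort \<Omega> t (snd x)" and wE': "well_sorted_eqs \<Omega> E'"
      using 1(2) E by (auto simp: well_sorted_eqs_def)
    let ?\<sigma> = "Var(x := t)"
    have s\<sigma>: "sorted_subst \<Omega> ?\<sigma>" using sx by (auto intro!: sorted_substI)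
    define F where "F = map (\<lambda>(s, t). (s \<cdot> ?\<sigma>, t \<cdot> ?\<sigma>)) E'"
    have vF: "vars_eqs F \<subseteq> vars_eqs E - {x}"
    proof -
      have "x \<notin> vars_trm (s \<cdot> ?\<sigma>)" "vars_trm (s \<cdot> ?\<sigma>) \<subseteq> vars_trm s \<union> vars_trm t" for s
        using nx by (auto simp: vars_subst split: if_splits)
      moreover have "vars_trm t \<subseteq> vars_eqs E" "vars_eqs E' \<subseteq> vars_eqs E" using E by auto
      ultimately show ?thesis unfolding F_def by fastforce
    qed
    have "x \<in> vars_eqs E" using E by auto
    then have "card (vars_eqs F) < card (vars_eqs E)"
      using vF by (intro psubset_card_mono[OF fin]) blast
    then have mF: "(F, E) \<in> measures [\<lambda>E. card (vars_eqs E), \<lambda>E. \<Sum>(s, t)\<leftarrow>E. size s + size t, length]"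
      by simp
    have wF: "well_sorted_eqs \<Omega> F"
      using wE' has_sort_subst[OF _ s\<sigma>] by (fastforce simp: well_sorted_eqs_def F_def)
    have uF: "unifies \<delta> F" if "unifies \<delta> E" for \<delta> :: "('f, 's) subst"
      using eq(2)[OF that] by (auto simp: unifies_def F_def subst_upd_absorb[of \<delta> x t, OF eq(1)[OF that]])
    from 1(1)[OF mF wF uF[OF 1(3)]] obtain \<theta> where \<theta>: "sorted_subst \<Omega> \<theta>" "unifies \<theta> F"
      "\<And>(\<delta> :: ('f, 's) subst) y. unifies \<delta> F \<Longrightarrow> \<delta> y = \<theta> y \<cdot> \<delta>"
      by blast
    let ?\<theta> = "\<lambda>y. ?\<sigma> y \<cdot> \<theta>"
    have "t \<cdot> ?\<theta> = t \<cdot> \<theta>" using nx by (intro subst_cong) auto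
    then have "unifies ?\<theta> E"
      using \<theta>(2) E by (auto simp: unifies_def F_def subst_subst split: prod.splits)
    moreover have "\<delta> y = ?\<theta> y \<cdot> \<delta>" if d: "unifies \<delta> E" for \<delta> :: "('f, 's) subst" and y
    \<comment> \<open>As a unifier of \<open>F\<close>, \<open>\<delta>\<close> absorbs
      \<open>\<theta>\<close>; because \<open>\<delta> x = t \<cdot> \<delta>\<close>, it absorbs
      the binding of \<open>x\<close> as well.\<close>
    proof -
      have "?\<theta> y \<cdot> \<delta> = ?\<sigma> y \<cdot> (\<lambda>z. \<theta> z \<cdot> \<delta>)" by (simp only: subst_subst)
      also have "\<dots> = ?\<sigma> y \<cdot> \<delta>" using \<theta>(3)[OF uF[OF d]] by (intro subst_cong) simp
      also have "\<dots> = \<delta> y" by (simp add: eq(1)[OF d, symmetric])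
      finally show ?thesis by simp
    qed
    ultimately show ?case using sorted_subst_comp[OF s\<sigma> \<theta>(1)] by blast
  qed
  show ?case
  proof (cases E)
    case Nil
    then show ?thesis
      by (intro exI[of _ Var]) (simp add: sorted_subst_Var unifies_def)
  next
    case (Cons e E')
    obtain s t where e: "e = (s, t)" by force
    consider (triv) x where "s = Var x" "t = Var x" | (left) x where "s = Var x" "t \<noteq> Var x"
      | (right) x where "t = Var x" "s \<noteq> Var x" | (Fun) f ss g ts where "s = Fun f ss" "t = Fun g ts"
      by (cases s; cases t) auto
    then show ?thesis
    proof cases
      case triv
      have "vars_eqs E' \<subseteq> vars_eqs E" using Cons by auto
      then have "card (vars_eqs E') \<le> card (vars_eqs E)" using fin by (rule card_mono[rotated])
      then have "(E', E) \<in> measures [\<lambda>E. card (vars_eqs E), \<lambda>E. \<Sum>(s, t)\<leftarrow>E. size s + size t, length]"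
        using Cons e by auto
      moreover have u: "unifies \<delta> E \<longleftrightarrow> unifies \<delta> E'" for \<delta> :: "('f, 's) subst"
        using Cons e triv by (auto simp: unifies_def)
      moreover have "well_sorted_eqs \<Omega> E'" using 1(2) Cons by (auto simp: well_sorted_eqs_def)
      ultimately show ?thesis using 1(1)[of E'] 1(3) by simp
    next
      case left
      then show ?thesis using elim[of x t E'] Cons e by simp
    next
      case right
      then show ?thesis using elim[of x s E'] Cons e by simp
    next
      case Fun
      from 1(2) Cons e Fun obtain a where a: "has_sort \<Omega> (Fun f ss) a" "has_sort \<Omega> (Fun g ts) a"
        and wE': "well_sorted_eqs \<Omega> E'"
        by (auto simp: well_sorted_eqs_def)
      \<comment> \<open>The given unifier excludes a clash of head symbols; the common declaration
        of the symbol then gives argument lists of equal length.\<close>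
      from 1(3) Cons e Fun have fg: "f = g" by (auto simp: unifies_def)
      from a fg obtain as where as: "list_all2 (has_sort \<Omega>) ss as" "list_all2 (has_sort \<Omega>) ts as"
        by (auto simp: has_sort_Fun)
      have len: "length ss = length ts" by (simp add: list_all2_lengthD[OF as(1)] list_all2_lengthD[OF as(2)])
      let ?E = "zip ss ts @ E'"
      have u: "unifies \<delta> E \<longleftrightarrow> unifies \<delta> ?E" for \<delta> :: "('f, 's) subst"
      proof -
        have "unifies \<delta> (zip ss ts) \<longleftrightarrow> map (\<lambda>t. t \<cdot> \<delta>) ss = map (\<lambda>t. t \<cdot> \<delta>) ts"
          using len by (induction ss ts rule: list_induct2) (auto simp: unifies_def)
        then show ?thesis by (auto simp: unifies_def Cons e Fun fg)
      qed
      have "vars_eqs (zip ss ts) \<subseteq> vars_trm s \<union> vars_trm t"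
        using Fun by (auto dest: set_zip_leftD set_zip_rightD)
      then have "vars_eqs ?E \<subseteq> vars_eqs E" using Cons e by auto
      then have "card (vars_eqs ?E) \<le> card (vars_eqs E)" using fin by (rule card_mono[rotated])
      moreover have "(\<Sum>(s, t)\<leftarrow>zip ss ts. size s + size t) < size s + size t"
        using len unfolding Fun by (induction ss ts rule: list_induct2) auto
      ultimately have "(?E, E) \<in> measures [\<lambda>E. card (vars_eqs E), \<lambda>E. \<Sum>(s, t)\<leftarrow>E. size s + size t, length]"
        using Cons e by auto
      moreover have "well_sorted_eqs \<Omega> ?E"
        using wE' as by (auto simp: well_sorted_eqs_def set_zip list_all2_conv_all_nth) blast
      ultimately show ?thesis using 1(1)[of ?E] 1(3) u by simp
    qed
  qed
qed

text \<open>The unifier \<open>\<delta>\<close> rules out clash and occurs-check failure. Most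
  generality follows from absorption: each sorted unifier is its own factor
  \<open>\<tau>\<close>.\<close>

lemma mgu_exists:
  fixes \<delta> :: "('f, 's) subst"
  assumes "has_sort \<Omega> s a" "has_sort \<Omega> t a" "s \<cdot> \<delta> = t \<cdot> \<delta>"
  shows "\<exists>\<theta>. is_mgu \<Omega> \<theta> s t"
proof -
  have "well_sorted_eqs \<Omega> [(s, t)]" "unifies \<delta> [(s, t)]"
    using assms by (auto simp: well_sorted_eqs_def unifies_def)
  from mgu_eqs_exists[OF this] obtain \<theta> where
    "sorted_subst \<Omega> \<theta>" "s \<cdot> \<theta> = t \<cdot> \<theta>" "\<And>(\<delta>' :: ('f, 's) subst) x. s \<cdot> \<delta>' = t \<cdot> \<delta>' \<Longrightarrow> \<delta>' x = \<theta> x \<cdot> \<delta>'"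
    by (auto simp: unifies_def)
  then show ?thesis unfolding is_mgu_def by blast
qed

text \<open>A matcher for a linear term is read off the other term at the unique position of each
  variable.\<close>

definition var_pos :: "('f, 'v) trm \<Rightarrow> 'v \<Rightarrow> pos" where
  "var_pos u x = (SOME p. p \<in> poss u \<and> u |_ p = Var x)"

lemma var_pos_linear: "linear_trm u \<Longrightarrow> p \<in> poss u \<Longrightarrow> u |_ p = Var x \<Longrightarrow> var_pos u x = p"
  unfolding var_pos_def linear_trm_def by (rule some_equality) auto

lemma poss_snoc: "p \<in> poss t \<Longrightarrow> t |_ p = Fun f ts \<Longrightarrow> i < length ts \<Longrightarrow>
    p @ [i] \<in> poss t \<and> t |_ (p @ [i]) = ts ! i"
  by (auto simp: poss_append subt_at_append intro!: bexI[of _ i])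

text \<open>Descend in \<open>u\<close> and \<open>t\<close> simultaneously. Where \<open>u\<close>
  has a function symbol, so has \<open>t\<close>, since a variable of \<open>t\<close> is sent to a
  variable by \<open>\<theta>\<close> and cannot equal an instance of a \<open>Fun\<close> term. So
  all positions of \<open>u\<close> exist in \<open>t\<close>, and linearity gives each variable
  just one subterm to be bound to.\<close>

lemma linear_match_if_unifiable:
  assumes "linear_trm u" "u \<cdot> \<delta> = t \<cdot> \<theta>" "\<And>x. x \<in> vars_trm t \<Longrightarrow> \<theta> x \<in> range Var"
  shows "\<exists>\<tau>. t = u \<cdot> \<tau>"
proof -
  define \<tau> where "\<tau> x = t |_ var_pos u x" for x
  have "v \<cdot> \<tau> = t |_ p" if "p \<in> poss u" "u |_ p = v" "p \<in> poss t" for v p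
    using that
  proof (induction v arbitrary: p)
    case (Var x)
    then show ?case using var_pos_linear[OF assms(1)] by (simp add: \<tau>_def)
  next
    case (Fun f us)
    have eq: "t |_ p \<cdot> \<theta> = Fun f us \<cdot> \<delta>"
      using subt_at_subst[of p u \<delta>] subt_at_subst[of p t \<theta>] Fun.prems assms(2) by simp
    obtain ts where ts: "t |_ p = Fun f ts" "length ts = length us"
    proof (cases "t |_ p")
      case (Var y)
      then have "y \<in> vars_trm t" using vars_subt_at[OF Fun.prems(3)] by auto
      then show ?thesis using assms(3)[of y] eq Var by auto
    next
      case (Fun g ts)
      then show ?thesis using eq that[of ts] by (auto dest: arg_cong[of _ _ length])
    qed
    have "us ! i \<cdot> \<tau> = ts ! i" if i: "i < length us" for i
      using Fun.IH[of "us ! i" "p @ [i]"] poss_snoc[OF Fun.prems(1,2) i]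
        poss_snoc[OF Fun.prems(3) ts(1), of i] ts(2) i by simp
    then show ?case using ts by (simp add: list_eq_iff_nth_eq)
  qed
  from this[of "[]" u] have "t = u \<cdot> \<tau>" by simp
  then show ?thesis by blast
qed

text \<open>If \<open>x\<close> stood at no position shared with \<open>u\<close>, the mgu could be
  altered to leave \<open>x\<close> alone and would still unify. This less committed unifier does
  not factor through \<open>\<theta>\<close>, because \<open>\<theta> x\<close> starts with a
  function symbol.\<close>

lemma mgu_nonvar_occurs:
  assumes lin: "linear_trm u" and "vars_trm u \<inter> vars_trm t = {}" and mgu: "is_mgu \<Omega> \<theta> u t"
    and su: "has_sort \<Omega> u a" and st: "has_sort \<Omega> t a" and x: "\<theta> x \<notin> range Var" "x \<notin> vars_trm u"
  shows "\<exists>p\<in>poss u \<inter> poss t. t |_ p = Var x"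
proof (rule ccontr)
  assume no: "\<not> ?thesis"
  have \<theta>: "sorted_subst \<Omega> \<theta>" "u \<cdot> \<theta> = t \<cdot> \<theta>" using mgu by (auto simp: is_mgu_def)
  define \<sigma> where "\<sigma> = \<theta>(x := Var x)"
  \<comment> \<open>A variable of \<open>u\<close> is rebound to what the altered instance of
    \<open>t\<close> shows at its place. If \<open>t\<close> ends above that place, it does so in a
    variable other than \<open>x\<close>, and the old binding stays right.\<close>
  define \<delta> where "\<delta> y = (if y \<in> vars_trm u
      then if var_pos u y \<in> poss t then (t |_ var_pos u y) \<cdot> \<sigma> else \<theta> y else \<sigma> y)" for y
  have "v \<cdot> \<delta> = (t |_ p) \<cdot> \<sigma>" if "p \<in> poss u" "u |_ p = v" "p \<in> poss t" for v p
    using that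
  proof (induction v arbitrary: p)
    case (Var y)
    then have "y \<in> vars_trm u" using vars_subt_at by fastforce
    then show ?case using var_pos_linear[OF lin] Var by (simp add: \<delta>_def)
  next
    case (Fun f us)
    have eq: "t |_ p \<cdot> \<theta> = Fun f us \<cdot> \<theta>"
      using subt_at_subst[of p u \<theta>] subt_at_subst[of p t \<theta>] Fun.prems \<theta>(2) by simp
    show ?case
    proof (cases "t |_ p")
      case (Var z)
      then have "z \<noteq> x" using no Fun.prems by auto
      then have "t |_ p \<cdot> \<sigma> = Fun f us \<cdot> \<theta>" using eq Var by (simp add: \<sigma>_def)
      moreover have "Fun f us \<cdot> \<delta> = Fun f us \<cdot> \<theta>"
      proof (rule subst_cong)
        fix y assume y: "y \<in> vars_trm (Fun f us)"
        then obtain q where q: "q \<in> poss (Fun f us)" "Fun f us |_ q = Var y"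
          using vars_trm_pos[OF y] by blast
        then have "var_pos u y = p @ q"
          by (intro var_pos_linear[OF lin])
            (simp_all only: poss_append subt_at_append[OF Fun.prems(1)] Fun.prems(1,2) simp_thms)
        \<comment> \<open>\<open>q\<close> is not empty, because the subterm of
          \<open>Fun f us\<close> there is a variable, whereas \<open>t\<close> ends at
          \<open>p\<close>.\<close>
        moreover have "p @ q \<notin> poss t" using q(2) Var by (cases q) (auto simp: poss_append)
        moreover have "y \<in> vars_trm u" using vars_subt_at[OF Fun.prems(1)] y Fun.prems(2) by auto
        ultimately show "\<delta> y = \<theta> y" by (simp add: \<delta>_def)
      qed
      ultimately show ?thesis by simp
    next
      case (Fun g ts)
      then have gf: "g = f" and len: "length ts = length us"
        using eq by (auto dest: arg_cong[of _ _ length])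
      have "us ! i \<cdot> \<delta> = ts ! i \<cdot> \<sigma>" if i: "i < length us" for i
        using Fun.IH[of "us ! i" "p @ [i]"] poss_snoc[OF Fun.prems(1,2) i]
          poss_snoc[OF Fun.prems(3) Fun, of i] len i by simp
      then show ?thesis using Fun gf len by (simp add: list_eq_iff_nth_eq)
    qed
  qed
  from this[of "[]" u] have "u \<cdot> \<delta> = t \<cdot> \<sigma>" by simp
  also have "\<dots> = t \<cdot> \<delta>" using assms(2) by (intro subst_cong) (auto simp: \<delta>_def)
  finally have uni: "u \<cdot> \<delta> = t \<cdot> \<delta>" .
  have s\<sigma>: "sorted_subst \<Omega> \<sigma>" using sorted_substD[OF \<theta>(1)] by (auto simp: \<sigma>_def intro!: sorted_substI)
  have "has_sort \<Omega> (u \<cdot> \<delta>) a" using \<open>u \<cdot> \<delta> = t \<cdot> \<sigma>\<close> has_sort_subst[OF st s\<sigma>] by simp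
  then have "has_sort \<Omega> (\<delta> y) (snd y)" if "y \<in> vars_trm u" for y
    using has_sort_subst_vars[OF su _ _ that] by blast
  moreover have "has_sort \<Omega> (\<delta> y) (snd y)" if "y \<notin> vars_trm u" for y
    using that sorted_substD[OF s\<sigma>] by (simp add: \<delta>_def)
  ultimately have "sorted_subst \<Omega> \<delta>" by (blast intro: sorted_substI)
  with uni mgu obtain \<tau> where "\<delta> x = \<theta> x \<cdot> \<tau>" unfolding is_mgu_def by blast
  moreover have "\<delta> x = Var x" using x(2) by (simp add: \<delta>_def \<sigma>_def)
  ultimately show False using x(1) by (cases "\<theta> x") auto
qed

section \<open>Fresh variables\<close>

lemma fresh_vars:
  assumes "finite V"
  shows "\<exists>xs :: 's var list. map snd xs = ss \<and> distinct xs \<and> set xs \<inter> V = {}"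
proof -
  from assms obtain N where N: "\<And>x. x \<in> V \<Longrightarrow> fst x < N"
    by (metis finite_imageI finite_nat_set_iff_bounded imageI)
  let ?xs = "zip [N..<N + length ss] ss"
  have "x \<notin> V" if "x \<in> set ?xs" for x
  proof -
    have "fst x \<in> set [N..<N + length ss]"
      using that set_zip_leftD[of "fst x" "snd x"] by (metis prod.collapse)
    with N[of x] show ?thesis by auto
  qed
  then show ?thesis by (intro exI[of _ ?xs]) (auto simp: distinct_zipI1)
qed

text \<open>Lets the fresh variables of a transformed rule take the actual arguments while the match
  of the original rule is left intact.\<close>

lemma subst_extend:
  "distinct xs \<Longrightarrow> list_all2 (has_sort \<Omega>) ts (map snd xs) \<Longrightarrow> sorted_subst \<Omega> \<sigma> \<Longrightarrow>
   \<exists>\<sigma>'. sorted_subst \<Omega> \<sigma>' \<and> map \<sigma>' xs = ts \<and> (\<forall>y. y \<notin> set xs \<longrightarrow> \<sigma>' y = \<sigma> y)"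
proof (induction xs arbitrary: ts)
  case (Cons x xs)
  then obtain t us where ts: "ts = t # us" "has_sort \<Omega> t (snd x)" "list_all2 (has_sort \<Omega>) us (map snd xs)"
    by (auto simp: list_all2_Cons2)
  with Cons obtain \<sigma>' where \<sigma>': "sorted_subst \<Omega> \<sigma>'" "map \<sigma>' xs = us" "\<forall>y. y \<notin> set xs \<longrightarrow> \<sigma>' y = \<sigma> y"
    by auto
  have "sorted_subst \<Omega> (\<sigma>'(x := t))"
    using ts(2) sorted_substD[OF \<sigma>'(1)] by (intro sorted_substI) simp
  moreover have "map (\<sigma>'(x := t)) (x # xs) = ts" using \<sigma>'(2) ts(1) Cons.prems(1) by simp
  moreover have "(\<sigma>'(x := t)) y = \<sigma> y" if "y \<notin> set (x # xs)" for y
    using spec[OF \<sigma>'(3), of y] that by simp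
  ultimately show ?case by blast
qed auto

lemma poss_rename: "poss (u \<cdot> (\<lambda>x. Var (\<rho> x))) = poss u"
  by (induction u) auto

lemma linear_rename:
  assumes "linear_trm u" "inj \<rho>"
  shows "linear_trm (u \<cdot> (\<lambda>x. Var (\<rho> x)))"
proof -
  let ?r = "\<lambda>x. Var (\<rho> x)"
  have *: "\<exists>y. u |_ p = Var y \<and> \<rho> y = x" if "p \<in> poss u" "(u \<cdot> ?r) |_ p = Var x" for p x
    using that subt_at_subst[of p u ?r] by (cases "u |_ p") auto
  have "p = q" if "p \<in> poss u" "q \<in> poss u" "(u \<cdot> ?r) |_ p = Var x" "(u \<cdot> ?r) |_ q = Var x" for p q x
    using *[OF that(1,3)] *[OF that(2,4)] that(1,2) assms(1) injD[OF assms(2)]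
    unfolding linear_trm_def by metis
  then show ?thesis by (auto simp: linear_trm_def poss_rename)
qed

lemma has_sort_rename:
  "\<forall>x. snd (\<rho> x) = snd x \<Longrightarrow> has_sort \<Omega> u a \<Longrightarrow> has_sort \<Omega> (u \<cdot> (\<lambda>x. Var (\<rho> x))) a"
  by (erule has_sort_subst, rule sorted_substI) (simp only: has_sort_Var)

text \<open>A violation of stability comes with one substitution for the rule and another for the
  pattern. Once the pattern is renamed apart, the two merge into the single unifier that
  \<open>RV\<close> and \<open>T_ext\<close> ask for.\<close>

lemma variant_unifier:
  fixes l u :: "('f, 's) sterm"
  assumes "sorted_subst \<Omega> \<sigma>" "sorted_subst \<Omega> \<theta>"
  obtains \<rho> \<delta> where "variant_apart l u (u \<cdot> (\<lambda>x. Var (\<rho> x)))" "inj \<rho>" "\<forall>x. snd (\<rho> x) = snd x"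
    "sorted_subst \<Omega> \<delta>" "\<And>v. v \<cdot> (\<lambda>x. Var (\<rho> x)) \<cdot> \<delta> = v \<cdot> \<theta>" "\<And>x. x \<in> vars_trm l \<Longrightarrow> \<delta> x = \<sigma> x"
proof -
  obtain N where N: "\<And>x. x \<in> vars_trm l \<Longrightarrow> fst x < N"
    by (metis finite_vars finite_imageI finite_nat_set_iff_bounded imageI)
  \<comment> \<open>Shifting the index by a bound on the indices in \<open>l\<close> avoids its
    variables and preserves sorts.\<close>
  define \<rho> :: "'s var \<Rightarrow> 's var" where "\<rho> x = (fst x + N, snd x)" for x
  have inj: "inj \<rho>" by (auto simp: inj_def \<rho>_def prod_eq_iff)
  have s\<rho>: "\<forall>x. snd (\<rho> x) = snd x" by (simp add: \<rho>_def)
  have apart: "range \<rho> \<inter> vars_trm l = {}" using N by (fastforce simp: \<rho>_def)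
  define \<delta> where "\<delta> y = (if y \<in> range \<rho> then \<theta> (inv \<rho> y) else \<sigma> y)" for y
  have "has_sort \<Omega> (\<delta> y) (snd y)" for y
    using sorted_substD[OF assms(1), of y] sorted_substD[OF assms(2), of "inv \<rho> y"] s\<rho> inj
    by (auto simp: \<delta>_def)
  then have "sorted_subst \<Omega> \<delta>" by (rule sorted_substI)
  moreover have "v \<cdot> (\<lambda>x. Var (\<rho> x)) \<cdot> \<delta> = v \<cdot> \<theta>" for v
    unfolding subst_subst using inj by (intro subst_cong) (simp add: \<delta>_def)
  moreover have "\<delta> x = \<sigma> x" if "x \<in> vars_trm l" for x using that apart by (auto simp: \<delta>_def)
  moreover have "variant_apart l u (u \<cdot> (\<lambda>x. Var (\<rho> x)))"
    unfolding variant_apart_def vars_subst_Var using inj s\<rho> apart by blast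
  ultimately show ?thesis using that inj s\<rho> by blast
qed

lemma fun_poss_subst: "fun_poss t \<subseteq> fun_poss (t \<cdot> \<sigma>)"
proof
  fix p assume "p \<in> fun_poss t"
  then show "p \<in> fun_poss (t \<cdot> \<sigma>)"
    using subt_at_subst[of p t \<sigma>] by (cases "t |_ p") (auto simp: fun_poss_def)
qed

text \<open>With bounded arities, the positions of bounded length form a finite set; the termination
  measure counts within it.\<close>

lemma has_sort_poss_bounded:
  assumes "\<And>f ss s. \<Omega> f = Some (ss, s) \<Longrightarrow> length ss \<le> A"
  shows "has_sort \<Omega> t s \<Longrightarrow> p \<in> poss t \<Longrightarrow> set p \<subseteq> {..<A}"
proof (induction p arbitrary: t s)
  case (Cons i p)
  then obtain f ts where t: "t = Fun f ts" "i < length ts" "p \<in> poss (ts ! i)"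
    by (cases t) auto
  with Cons.prems obtain ss where ss: "\<Omega> f = Some (ss, s)" "list_all2 (has_sort \<Omega>) ts ss"
    by (auto simp: has_sort_Fun)
  have "i < A" using assms[OF ss(1)] list_all2_lengthD[OF ss(2)] t(2) by simp
  moreover have "set p \<subseteq> {..<A}"
    using Cons.IH[OF list_all2_nthD[OF ss(2) t(2)] t(3)] .
  ultimately show ?case by simp
qed simp

section \<open>The transformation\<close>

lemma rstep_at_iff: "rstep_at (\<Omega>, R) p s t \<longleftrightarrow>
    (\<exists>l r C \<sigma>. (l, r) \<in> R \<and> sorted_subst \<Omega> \<sigma> \<and> hole_pos C = p \<and> s = C\<langle>l \<cdot> \<sigma>\<rangle> \<and> t = C\<langle>r \<cdot> \<sigma>\<rangle>)"
  by (simp add: rstep_at_def split_beta Bex_def)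

lemma rstep_iff: "rstep (\<Omega>, R) s t \<longleftrightarrow>
    (\<exists>l r C \<sigma>. (l, r) \<in> R \<and> sorted_subst \<Omega> \<sigma> \<and> s = C\<langle>l \<cdot> \<sigma>\<rangle> \<and> t = C\<langle>r \<cdot> \<sigma>\<rangle>)"
  unfolding rstep_def rstep_at_iff by blast

locale forbidden_patterns =
  fixes \<Omega> :: "('f, 's::finite) signature"
    and R :: "('f, 's) rule set"
    and \<Pi> :: "('f, 's) pattern set"
    and tp :: "'s \<Rightarrow> 'f"
  assumes finite_sig: "finite (dom \<Omega>)"
    and trs: "is_trs (\<Omega>, R)"
    and inj_tp: "inj tp" and tp_fresh: "range tp \<inter> dom \<Omega> = {}"
    and finite_patterns: "finite \<Pi>" and patterns: "\<forall>\<pi>\<in>\<Pi>. is_pattern \<Omega> \<pi>"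
    and linear: "\<forall>(u, k, h)\<in>\<Pi>. h = Here \<and> linear_trm u"
begin

abbreviation \<Omega>' :: "('f, 's) signature" where "\<Omega>' \<equiv> top_ext tp \<Omega>"

lemma ext_sig: "f \<in> dom \<Omega> \<Longrightarrow> \<Omega>' f = \<Omega> f"
  using tp_fresh by (auto simp: top_ext_def)

lemma ext_sig_tp: "\<Omega>' (tp a) = Some ([a], a)"
  using inj_tp by (auto simp: top_ext_def)

lemma ext_sort: "has_sort \<Omega> t s \<Longrightarrow> has_sort \<Omega>' t s"
  by (erule has_sort_extend) (rule ext_sig)

lemma ext_subst: "sorted_subst \<Omega> \<sigma> \<Longrightarrow> sorted_subst \<Omega>' \<sigma>"
  by (simp add: sorted_subst_def ext_sort)

lemma patternD:
  assumes "(u, k, h) \<in> \<Pi>"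
  shows "linear_trm u" "k \<in> poss u" "\<exists>s. has_sort \<Omega> u s"
  using assms linear patterns by (auto simp: is_pattern_def)

lemma ruleD:
  assumes "(l, r) \<in> R"
  shows "\<exists>s. has_sort \<Omega> l s \<and> has_sort \<Omega> r s" "l \<notin> range Var" "vars_trm r \<subseteq> vars_trm l"
  using assms trs by (auto simp: is_trs_def)

text \<open>An instance that is sorted over \<open>\<Omega>\<close> leaves no room for top symbols
  in the bindings of the variables that occur in \<open>u\<close>. This turns matches over
  \<open>\<Omega>'\<close> into matches that \<open>fp_step\<close> recognises.\<close>

lemma match_restrict:
  assumes "has_sort \<Omega> u b" "has_sort \<Omega> (u \<cdot> \<theta>) c" "sorted_subst \<Omega>' \<theta>"
  shows "\<exists>\<theta>'. sorted_subst \<Omega> \<theta>' \<and> (\<forall>x\<in>vars_trm u. \<theta>' x = \<theta> x)"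
proof -
  have "b = c"
    using has_sort_unique[OF has_sort_subst[OF ext_sort[OF assms(1)] assms(3)] ext_sort[OF assms(2)]] .
  with assms(1,2) have "sorted_subst \<Omega> (\<lambda>x. if x \<in> vars_trm u then \<theta> x else Var x)"
    by (intro sorted_subst_restrict) auto
  then show ?thesis by (intro exI) auto
qed

section \<open>Shape of the rules produced by the loop\<close>

text \<open>Invariant of the loop. The stored position is the hole of the accumulated context, so it
  marks where the original rule sits.\<close>

definition derived :: "('f, 's) prule \<Rightarrow> bool" where
  "derived = (\<lambda>((l, r), p). (\<exists>a. has_sort \<Omega>' l a) \<and> (\<exists>l0 r0 D \<tau>. (l0, r0) \<in> R \<and>
     sorted_subst \<Omega>' \<tau> \<and> hole_pos D = p \<and> l = D\<langle>l0 \<cdot> \<tau>\<rangle> \<and> r = D\<langle>r0 \<cdot> \<tau>\<rangle>))"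

lemma derived_rule: "(l, r) \<in> R \<Longrightarrow> derived ((l, r), [])"
proof -
  assume lr: "(l, r) \<in> R"
  have "hole_pos Hole = []" "l = Hole\<langle>l \<cdot> Var\<rangle>" "r = Hole\<langle>r \<cdot> Var\<rangle>" by simp_all
  with lr show ?thesis
    unfolding derived_def using ruleD(1)[OF lr] ext_sort sorted_subst_Var by blast
qed

lemma derivedD:
  assumes "derived ((l, r), p)"
  shows "p \<in> poss l" "l |_ p \<notin> range Var" "l \<notin> range Var" "vars_trm r \<subseteq> vars_trm l"
    "\<exists>a. has_sort \<Omega>' l a" "p = [] \<Longrightarrow> \<exists>f ts. l = Fun f ts \<and> f \<in> dom \<Omega>"
proof -
  from assms obtain l0 r0 D \<tau> where lr: "(l0, r0) \<in> R" "hole_pos D = p"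
    "l = D\<langle>l0 \<cdot> \<tau>\<rangle>" "r = D\<langle>r0 \<cdot> \<tau>\<rangle>" by (auto simp: derived_def)
  obtain f ts where l0: "l0 = Fun f ts" using ruleD(2)[OF lr(1)] by (cases l0) auto
  have f: "f \<in> dom \<Omega>" using ruleD(1)[OF lr(1)] l0 by (auto simp: has_sort_Fun)
  show "p \<in> poss l" using lr(2,3) hole_pos_poss[of D "[]"] by auto
  show "l |_ p \<notin> range Var" using lr(2,3) l0 hole_pos_subt_at[of D "l0 \<cdot> \<tau>" "[]"] by auto
  show "l \<notin> range Var" using lr l0 by (cases D) auto
  obtain V where V: "\<forall>t. vars_trm D\<langle>t\<rangle> = V \<union> vars_trm t" using vars_ctxt[of D] by blast
  show "vars_trm r \<subseteq> vars_trm l"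
    unfolding lr(3,4) V[rule_format] vars_subst using ruleD(3)[OF lr(1)] by blast
  show "\<exists>a. has_sort \<Omega>' l a" using assms by (auto simp: derived_def)
  show "\<exists>f ts. l = Fun f ts \<and> f \<in> dom \<Omega>" if "p = []"
    using lr that l0 f by (cases D) auto
qed

lemma derived_T_step:
  assumes d: "derived \<rho>" and t: "\<rho>' \<in> T_step tp \<Omega> \<Pi> \<rho>"
  shows "derived \<rho>'"
proof -
  obtain l r p where \<rho>: "\<rho> = ((l, r), p)" by (metis prod.exhaust)
  from d \<rho> obtain l0 r0 D \<tau> a where lr: "(l0, r0) \<in> R" "sorted_subst \<Omega>' \<tau>" "hole_pos D = p"
    "l = D\<langle>l0 \<cdot> \<tau>\<rangle>" "r = D\<langle>r0 \<cdot> \<tau>\<rangle>" "has_sort \<Omega>' l a" by (auto simp: derived_def)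
  from t consider "\<rho>' \<in> T_inst tp \<Omega> \<Pi> \<rho>" | "\<rho>' \<in> T_ext tp \<Omega> \<Pi> \<rho>" by (auto simp: T_step_def)
  then show ?thesis
  proof cases
    case 1
    then obtain x f ss xs \<sigma> where x: "\<Omega> f = Some (ss, snd x)" "map snd xs = ss"
      "\<sigma> = Var(x := Fun f (map Var xs))" "\<rho>' = ((l \<cdot> \<sigma>, r \<cdot> \<sigma>), p)"
      by (auto simp: T_inst_def \<rho>)
    have "has_sort \<Omega> (Fun f (map Var xs)) (snd x)"
      using x(1,2) by (auto simp: has_sort_Fun list_all2_conv_all_nth)
    then have s\<sigma>: "sorted_subst \<Omega>' \<sigma>"
      using ext_sort by (auto simp: x(3) intro!: sorted_substI)
    obtain E where E: "hole_pos E = p" "\<forall>t. D\<langle>t\<rangle> \<cdot> \<sigma> = E\<langle>t \<cdot> \<sigma>\<rangle>"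
      using ctxt_subst[of D \<sigma>] lr(3) by auto
    show ?thesis
      unfolding derived_def x(4) using lr has_sort_subst[OF lr(6) s\<sigma>] E sorted_subst_comp[OF lr(2) s\<sigma>]
      by (auto simp: subst_subst)
  next
    case 2
    then obtain f b s xs ys where x: "has_sort \<Omega>' l b"
        "\<Omega>' f = Some (map snd xs @ b # map snd ys, s)"
        "\<rho>' = ((Fun f (map Var xs @ l # map Var ys), Fun f (map Var xs @ r # map Var ys)), length xs # p)"
      by (auto simp: T_ext_def \<rho>)
    have "list_all2 (has_sort \<Omega>') (map Var zs) (map snd zs)" for zs :: "'s var list"
      by (simp add: list_all2_conv_all_nth)
    then have "has_sort \<Omega>' (Fun f (map Var xs @ l # map Var ys)) s"
      using x(1,2) by (auto simp: has_sort_Fun intro!: list_all2_appendI)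
    moreover have "hole_pos (More f (map Var xs) D (map Var ys)) = length xs # p"
      "Fun f (map Var xs @ l # map Var ys) = (More f (map Var xs) D (map Var ys))\<langle>l0 \<cdot> \<tau>\<rangle>"
      "Fun f (map Var xs @ r # map Var ys) = (More f (map Var xs) D (map Var ys))\<langle>r0 \<cdot> \<tau>\<rangle>"
      using lr by auto
    ultimately show ?thesis
      unfolding derived_def x(3) using lr(1,2) by blast
  qed
qed

section \<open>Iterating the loop body\<close>

definition loop_body ::
  "('f, 's) prule set \<times> ('f, 's) prule set \<Rightarrow> ('f, 's) prule set \<times> ('f, 's) prule set" where
  "loop_body = (\<lambda>(R_tmp, R_acc).
     (\<Union>\<rho>\<in>{\<rho> \<in> R_tmp. \<not> stable \<Omega>' \<Pi> \<rho> \<and> \<not> obsolete \<Omega>' \<Pi> \<rho>}. T_step tp \<Omega> \<Pi> \<rho>,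
      R_acc \<union> {\<rho> \<in> R_tmp. stable \<Omega>' \<Pi> \<rho>}))"

text \<open>Counting rounds allows induction over the loop before its termination is known.\<close>

definition loop_state :: "nat \<Rightarrow> ('f, 's) prule set \<times> ('f, 's) prule set" where
  "loop_state n = (loop_body ^^ n) ((\<lambda>lr. (lr, [])) ` R, {})"

lemma loop_state_0: "loop_state 0 = ((\<lambda>lr. (lr, [])) ` R, {})"
  by (simp add: loop_state_def)

lemma fst_loop_state_Suc: "fst (loop_state (Suc n)) =
    (\<Union>\<rho>\<in>{\<rho> \<in> fst (loop_state n). \<not> stable \<Omega>' \<Pi> \<rho> \<and> \<not> obsolete \<Omega>' \<Pi> \<rho>}. T_step tp \<Omega> \<Pi> \<rho>)"
  by (simp add: loop_state_def loop_body_def split: prod.split)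

lemma snd_loop_state_Suc: "snd (loop_state (Suc n)) =
    snd (loop_state n) \<union> {\<rho> \<in> fst (loop_state n). stable \<Omega>' \<Pi> \<rho>}"
  by (simp add: loop_state_def loop_body_def split: prod.split)

lemma derived_loop_state: "\<rho> \<in> fst (loop_state n) \<Longrightarrow> derived \<rho>"
proof (induction n arbitrary: \<rho>)
  case 0
  then show ?case by (auto simp: loop_state_0 derived_rule)
next
  case (Suc n)
  then obtain \<rho>' where "\<rho>' \<in> fst (loop_state n)" "\<rho> \<in> T_step tp \<Omega> \<Pi> \<rho>'"
    by (auto simp: fst_loop_state_Suc)
  with Suc.IH derived_T_step show ?case by blast
qed

lemma accepted: "\<rho> \<in> snd (loop_state n) \<Longrightarrow> derived \<rho> \<and> stable \<Omega>' \<Pi> \<rho>"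
  by (induction n) (auto simp: loop_state_0 snd_loop_state_Suc derived_loop_state)

text \<open>
  An extension step lengthens the position \<open>p\<close>, which never outgrows the pattern positions.
  An instantiation step turns a variable position of the left-hand side into a function
  position; since the mgu with a linear pattern instantiates only variables lying within the
  pattern, this happens at bounded depth. The number of iterations is thus bounded independently
  of the rules, even for an infinite \<open>R\<close>.
\<close>

lemma T_step_measure:
  obtains \<mu> :: "('f, 's) prule \<Rightarrow> nat" and M B where
    "\<And>\<rho>. length (snd \<rho>) \<le> B \<Longrightarrow> \<mu> \<rho> \<le> M"
    "\<And>\<rho> \<rho>'. derived \<rho> \<Longrightarrow> length (snd \<rho>) \<le> B \<Longrightarrow> \<rho>' \<in> T_step tp \<Omega> \<Pi> \<rho> \<Longrightarrow>
       length (snd \<rho>') \<le> B \<and> \<mu> \<rho>' < \<mu> \<rho>"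
proof -
  let ?L = "\<Union>(u, k, h)\<in>\<Pi>. length ` poss u"
  have "finite ?L" using finite_patterns by auto
  then obtain B where B0: "\<forall>n\<in>?L. n \<le> B" using finite_nat_set_iff_bounded_le by blast
  have B: "length p \<le> B" if "(u, k, h) \<in> \<Pi>" "p \<in> poss u" for u k h p
    using that by (intro bspec[OF B0]) auto
  have "dom \<Omega>' \<subseteq> dom \<Omega> \<union> range tp" by (auto simp: top_ext_def split: if_splits)
  then have "finite (dom \<Omega>')" by (rule finite_subset) (simp add: finite_sig)
  then have "finite ((\<lambda>f. length (fst (the (\<Omega>' f)))) ` dom \<Omega>')" by simp
  then obtain A where A0: "\<forall>n\<in>(\<lambda>f. length (fst (the (\<Omega>' f)))) ` dom \<Omega>'. n \<le> A"
    using finite_nat_set_iff_bounded_le by blast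
  have A: "length ss \<le> A" if "\<Omega>' f = Some (ss, s)" for f ss s
    using that by (intro bspec[OF A0]) (force simp: image_iff)
  \<comment> \<open>The bound \<open>B + B\<close> accommodates a prefix \<open>q\<close> of the
    rule position followed by a pattern position, each of length at most \<open>B\<close>.\<close>
  define P where "P = {p. set p \<subseteq> {..<A} \<and> length p \<le> B + B}"
  have finP: "finite P" unfolding P_def by (rule finite_lists_length_le) simp
  define N where "N = card P"
  \<comment> \<open>A lexicographic pair coded as one number, with weight \<open>Suc N\<close>
    because the second entry is at most \<open>N\<close>. An extension replaces the left-hand side
    and may raise the second entry; the longer position outweighs this.\<close>
  define \<mu> :: "('f, 's) prule \<Rightarrow> nat" where
    "\<mu> = (\<lambda>((l, r), p). (B - length p) * Suc N + (N - card (fun_poss l \<inter> P)))"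
  have "\<mu> \<rho> \<le> B * Suc N + N" for \<rho>
    unfolding \<mu>_def by (auto split: prod.split intro!: add_mono mult_le_mono)
  moreover have "length (snd \<rho>') \<le> B \<and> \<mu> \<rho>' < \<mu> \<rho>"
    if d: "derived \<rho>" and len: "length (snd \<rho>) \<le> B" and t: "\<rho>' \<in> T_step tp \<Omega> \<Pi> \<rho>" for \<rho> \<rho>'
  proof -
    obtain l r p where \<rho>: "\<rho> = ((l, r), p)" by (metis prod.exhaust)
    obtain a where sl: "has_sort \<Omega>' l a" using derivedD(5) d \<rho> by blast
    from t consider (inst) "\<rho>' \<in> T_inst tp \<Omega> \<Pi> \<rho>" | (ext) "\<rho>' \<in> T_ext tp \<Omega> \<Pi> \<rho>"
      by (auto simp: T_step_def)
    then show ?thesis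
    proof cases
      case ext
      then obtain i l' r' u k u' q h where x: "\<rho>' = ((l', r'), i # p)" "(u, k, h) \<in> \<Pi>" "q \<noteq> []" "k = q @ p"
        by (auto simp: T_ext_def \<rho>)
      have "length k \<le> B" using B[OF x(2)] patternD(2)[OF x(2)] by blast
      \<comment> \<open>Since \<open>k = q @ p\<close>, a non-empty \<open>q\<close> leaves room for
        the one index that the extension adds to \<open>p\<close>.\<close>
      moreover have "length q \<ge> 1" using x(3) by (cases q) auto
      ultimately have len': "Suc (length p) \<le> B" using x(4) by simp
      have "\<mu> \<rho>' \<le> (B - Suc (length p)) * Suc N + N" by (simp add: \<mu>_def x(1))
      also have "\<dots> < Suc (B - Suc (length p)) * Suc N" by simp
      also have "\<dots> = (B - length p) * Suc N" using len' by (simp add: Suc_diff_le del: mult_Suc mult_Suc_right)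
      also have "\<dots> \<le> \<mu> \<rho>" by (simp add: \<mu>_def \<rho>)
      finally show ?thesis using len' x(1) by simp
    next
      case inst
      then obtain x f xs \<sigma> where x: "x \<in> RV \<Omega>' \<Pi> l p" "\<sigma> = Var(x := Fun f (map Var xs))"
        "\<rho>' = ((l \<cdot> \<sigma>, r \<cdot> \<sigma>), p)"
        by (auto simp: T_inst_def \<rho>)
      from x(1) obtain u k u' q \<theta> where u: "x \<in> vars_trm l" "(u, k, Here) \<in> \<Pi>" "variant_apart l u u'"
        "q \<in> poss l" "is_mgu \<Omega>' \<theta> u' (l |_ q)" "q @ k = p" "\<theta> x \<notin> range Var"
        by (auto simp: RV_def)
      from u(3) obtain \<eta> where \<eta>: "inj \<eta>" "\<forall>x. snd (\<eta> x) = snd x" "u' = u \<cdot> (\<lambda>x. Var (\<eta> x))"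
        "vars_trm u' \<inter> vars_trm l = {}"
        by (auto simp: variant_apart_def)
      obtain b where "has_sort \<Omega> u b" using patternD(3)[OF u(2)] by blast
      then have su': "has_sort \<Omega>' u' b" unfolding \<eta>(3) by (intro has_sort_rename[OF \<eta>(2)] ext_sort)
      obtain c where sq: "has_sort \<Omega>' (l |_ q) c" using has_sort_subt_at[OF sl u(4)] by blast
      have "b = c"
        using u(5) has_sort_subst[OF su'] has_sort_subst[OF sq] has_sort_unique
        unfolding is_mgu_def by metis
      moreover have "vars_trm u' \<inter> vars_trm (l |_ q) = {}" "x \<notin> vars_trm u'"
        using \<eta>(4) u(1) vars_subt_at[OF u(4)] by auto
      ultimately obtain p' where p': "p' \<in> poss u'" "p' \<in> poss (l |_ q)" "l |_ q |_ p' = Var x"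
        using mgu_nonvar_occurs[OF _ _ u(5) _ _ u(7)] linear_rename[OF patternD(1)[OF u(2)] \<eta>(1)]
          su' sq \<eta>(3) by blast
      have pos: "q @ p' \<in> poss l" "l |_ (q @ p') = Var x"
        using p' u(4) by (simp_all add: poss_append subt_at_append)
      have "length p' \<le> B" using B[OF u(2)] p'(1) \<eta>(3) by (simp add: poss_rename)
      then have inP: "q @ p' \<in> P"
        using has_sort_poss_bounded[OF A sl pos(1)] u(6) len \<rho> by (auto simp: P_def)
      have "q @ p' \<in> fun_poss (l \<cdot> \<sigma>)" "q @ p' \<notin> fun_poss l"
        using subt_at_subst[OF pos(1), of \<sigma>] pos(2) by (auto simp: fun_poss_def x(2))
      then have "fun_poss l \<inter> P \<subset> fun_poss (l \<cdot> \<sigma>) \<inter> P" using fun_poss_subst[of l \<sigma>] inP by blast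
      then have "card (fun_poss l \<inter> P) < card (fun_poss (l \<cdot> \<sigma>) \<inter> P)"
        using finP by (intro psubset_card_mono) auto
      moreover have "card (fun_poss (l \<cdot> \<sigma>) \<inter> P) \<le> N" unfolding N_def using finP by (intro card_mono) auto
      ultimately show ?thesis using len by (simp add: \<mu>_def \<rho> x(3))
    qed
  qed
  ultimately show ?thesis using that by blast
qed

lemma loop_terminates: "\<exists>n. fst (loop_state n) = {}"
proof -
  obtain \<mu> :: "('f, 's) prule \<Rightarrow> nat" and M B where
    M: "\<And>\<rho>. length (snd \<rho>) \<le> B \<Longrightarrow> \<mu> \<rho> \<le> M" and
    dec: "\<And>\<rho> \<rho>'. derived \<rho> \<Longrightarrow> length (snd \<rho>) \<le> B \<Longrightarrow> \<rho>' \<in> T_step tp \<Omega> \<Pi> \<rho> \<Longrightarrow>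
       length (snd \<rho>') \<le> B \<and> \<mu> \<rho>' < \<mu> \<rho>"
    by (rule T_step_measure) rule
  \<comment> \<open>Each round lowers \<open>\<mu>\<close> by at least one, so nothing can be
    pending after \<open>Suc M\<close> rounds.\<close>
  have "\<forall>\<rho>\<in>fst (loop_state n). length (snd \<rho>) \<le> B \<and> \<mu> \<rho> + n \<le> M" for n
  proof (induction n)
    case 0
    then show ?case using M by (auto simp: loop_state_0)
  next
    case (Suc n)
    show ?case
    proof
      fix \<rho>' assume "\<rho>' \<in> fst (loop_state (Suc n))"
      then obtain \<rho> where "\<rho> \<in> fst (loop_state n)" "\<rho>' \<in> T_step tp \<Omega> \<Pi> \<rho>"
        by (auto simp: fst_loop_state_Suc)
      then have "length (snd \<rho>) \<le> B \<and> \<mu> \<rho> + n \<le> M" "length (snd \<rho>') \<le> B \<and> \<mu> \<rho>' < \<mu> \<rho>"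
        using Suc.IH dec[of \<rho> \<rho>'] derived_loop_state by blast+
      then show "length (snd \<rho>') \<le> B \<and> \<mu> \<rho>' + Suc n \<le> M" by simp
    qed
  qed
  from this[of "Suc M"] have "fst (loop_state (Suc M)) = {}" by fastforce
  then show ?thesis ..
qed

lemma transform_loop_eq: "\<exists>n. fst (loop_state n) = {} \<and> transform_loop tp (\<Omega>, R) \<Pi> = loop_state n"
proof -
  let ?b = "\<lambda>(R_tmp, R_acc). R_tmp \<noteq> {}"
  let ?s = "((\<lambda>lr. (lr, [])) ` R, {})"
  let ?n = "LEAST k. \<not> ?b ((loop_body ^^ k) ?s)"
  have b: "?b ((loop_body ^^ k) ?s) \<longleftrightarrow> fst (loop_state k) \<noteq> {}" for k
    by (simp add: loop_state_def split: prod.split)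
  then have ex: "\<exists>k. \<not> ?b ((loop_body ^^ k) ?s)" using loop_terminates by simp
  have "transform_loop tp (\<Omega>, R) \<Pi> = while ?b loop_body ?s"
    by (simp add: transform_loop_def loop_body_def Let_def)
  \<comment> \<open>\<open>while\<close> takes \<open>the\<close> of an option that is defined by a
    least exit index; \<open>ex\<close> guarantees that this index exists.\<close>
  also have "\<dots> = loop_state ?n"
    using ex unfolding while_def while_option_def by (simp add: loop_state_def)
  finally have "transform_loop tp (\<Omega>, R) \<Pi> = loop_state ?n" .
  moreover have "fst (loop_state ?n) = {}" using LeastI_ex[OF ex] unfolding b by blast
  ultimately show ?thesis by blast
qed

section \<open>Progress of a rule that serves a fixed redex\<close>

text \<open>\<open>P\<close> is the absolute position of the original redex in \<open>S\<close>.
  Fixing \<open>S\<close>, \<open>T\<close> and \<open>P\<close> lets the rule be refined while the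
  step it performs stays the same.\<close>

definition redex :: "('f, 's) sterm \<Rightarrow> ('f, 's) sterm \<Rightarrow> pos \<Rightarrow> ('f, 's) prule \<Rightarrow> bool" where
  "redex S T P = (\<lambda>((l, r), p). \<exists>C \<sigma>. sorted_subst \<Omega>' \<sigma> \<and> hole_pos C @ p = P \<and>
     S = C\<langle>l \<cdot> \<sigma>\<rangle> \<and> T = C\<langle>r \<cdot> \<sigma>\<rangle>)"

text \<open>The innermost layer of \<open>C\<close> moves into the rule: its symbol becomes the new
  root, and its other arguments become bindings of the fresh variables.\<close>

lemma T_ext_progress:
  assumes d: "derived ((l, r), p)" and \<sigma>: "sorted_subst \<Omega>' \<sigma>" and S: "has_sort \<Omega>' C\<langle>l \<cdot> \<sigma>\<rangle> b"
    and C: "C \<noteq> Hole" and u: "(u, k, Here) \<in> \<Pi>" "variant_apart l u u'" "q \<in> poss u'" "q \<noteq> []"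
      "sorted_subst \<Omega>' \<theta>" "(u' |_ q) \<cdot> \<theta> = l \<cdot> \<theta>" "k = q @ p"
  shows "\<exists>\<rho>'\<in>T_ext tp \<Omega> \<Pi> ((l, r), p). redex C\<langle>l \<cdot> \<sigma>\<rangle> C\<langle>r \<cdot> \<sigma>\<rangle> (hole_pos C @ p) \<rho>'"
proof -
  obtain D f ss ts where D: "hole_pos C = hole_pos D @ [length ss]" "\<forall>t. C\<langle>t\<rangle> = D\<langle>Fun f (ss @ t # ts)\<rangle>"
    using ctxt_split_last[OF C] by blast
  obtain a where a: "has_sort \<Omega>' l a" using derivedD(5)[OF d] by blast
  obtain s where "has_sort \<Omega>' (Fun f (ss @ l \<cdot> \<sigma> # ts)) s"
    using has_sort_ctxt_hole S D(2) by metis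
  then obtain as c bs where f: "\<Omega>' f = Some (as @ c # bs, s)" "list_all2 (has_sort \<Omega>') ss as"
    "has_sort \<Omega>' (l \<cdot> \<sigma>) c" "list_all2 (has_sort \<Omega>') ts bs"
    by (auto simp: has_sort_Fun list_all2_append1 list_all2_Cons1)
  have c: "c = a" using has_sort_unique[OF f(3) has_sort_subst[OF a \<sigma>]] .
  obtain zs where zs: "map snd zs = as @ bs" "distinct zs" "set zs \<inter> (vars_trm l \<union> vars_trm r) = {}"
    using fresh_vars[of "vars_trm l \<union> vars_trm r" "as @ bs"] by auto
  then obtain xs ys where xy: "zs = xs @ ys" "as = map snd xs" "bs = map snd ys"
    by (auto simp: map_eq_append_conv)
  have "list_all2 (has_sort \<Omega>') (ss @ ts) (map snd zs)"
    unfolding zs(1) using f by (intro list_all2_appendI)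
  from subst_extend[OF zs(2) this \<sigma>] obtain \<sigma>' where \<sigma>': "sorted_subst \<Omega>' \<sigma>'"
    "map \<sigma>' zs = ss @ ts" "\<forall>y. y \<notin> set zs \<longrightarrow> \<sigma>' y = \<sigma> y" by blast
  have len: "length ss = length xs" using list_all2_lengthD[OF f(2)] xy(2) by simp
  then have m: "map \<sigma>' xs = ss" "map \<sigma>' ys = ts" using \<sigma>'(2) xy(1) by auto
  have lr: "l \<cdot> \<sigma>' = l \<cdot> \<sigma>" "r \<cdot> \<sigma>' = r \<cdot> \<sigma>" using \<sigma>'(3) zs(3) by (blast intro!: subst_cong)+
  let ?E = "More f (map Var xs) Hole (map Var ys)"
  have "((?E\<langle>l\<rangle>, ?E\<langle>r\<rangle>), length xs # p) \<in> T_ext tp \<Omega> \<Pi> ((l, r), p)"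
  proof -
    have *: "distinct (xs @ ys)" "set (xs @ ys) \<inter> (vars_trm l \<union> vars_trm r) = {}"
      "\<Omega>' f = Some (map snd xs @ a # map snd ys, s)" using zs xy f(1) c by auto
    have "\<exists>u k u' q \<theta>. (u, k, Here) \<in> \<Pi> \<and> variant_apart l u u' \<and> q \<in> poss u' \<and> q \<noteq> [] \<and>
           sorted_subst \<Omega>' \<theta> \<and> (u' |_ q) \<cdot> \<theta> = l \<cdot> \<theta> \<and> k = q @ p"
      using u by blast
    note ** = a * this
    show ?thesis unfolding T_ext_def prod.case mem_Collect_eq
      by (rule exI[of _ ?E], rule exI[of _ "length xs"], rule exI[of _ f], rule exI[of _ a],
          rule exI[of _ s], rule exI[of _ xs], rule exI[of _ ys]) (intro conjI refl **)
  qed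
  moreover have "redex C\<langle>l \<cdot> \<sigma>\<rangle> C\<langle>r \<cdot> \<sigma>\<rangle> (hole_pos C @ p) ((?E\<langle>l\<rangle>, ?E\<langle>r\<rangle>), length xs # p)"
  proof -
    have "?E\<langle>v\<rangle> \<cdot> \<sigma>' = Fun f (ss @ v \<cdot> \<sigma>' # ts)" for v using m by (simp add: comp_def)
    then have "C\<langle>l \<cdot> \<sigma>\<rangle> = D\<langle>?E\<langle>l\<rangle> \<cdot> \<sigma>'\<rangle>" "C\<langle>r \<cdot> \<sigma>\<rangle> = D\<langle>?E\<langle>r\<rangle> \<cdot> \<sigma>'\<rangle>"
      "hole_pos D @ length xs # p = hole_pos C @ p"
      using D lr len by simp_all
    with \<sigma>'(1) show ?thesis unfolding redex_def prod.case by blast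
  qed
  ultimately show ?thesis by blast
qed

text \<open>The term \<open>\<sigma> x\<close> is split: its root symbol moves into the rule, its
  arguments become bindings of the fresh variables.\<close>

lemma T_inst_progress:
  assumes d: "derived ((l, r), p)" and \<sigma>: "sorted_subst \<Omega>' \<sigma>" and x: "x \<in> RV \<Omega>' \<Pi> l p"
    and f: "\<sigma> x = Fun f ts" "f \<in> dom \<Omega>"
  shows "\<exists>\<rho>'\<in>T_inst tp \<Omega> \<Pi> ((l, r), p). redex C\<langle>l \<cdot> \<sigma>\<rangle> C\<langle>r \<cdot> \<sigma>\<rangle> (hole_pos C @ p) \<rho>'"
proof -
  have "has_sort \<Omega>' (Fun f ts) (snd x)" using sorted_substD[OF \<sigma>, of x] f(1) by simp
  then obtain ss where ss: "\<Omega> f = Some (ss, snd x)" "list_all2 (has_sort \<Omega>') ts ss"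
    using ext_sig[OF f(2)] by (auto simp: has_sort_Fun)
  obtain xs where xs: "map snd xs = ss" "distinct xs" "set xs \<inter> (vars_trm l \<union> vars_trm r) = {}"
    using fresh_vars[of "vars_trm l \<union> vars_trm r" ss] by auto
  obtain \<sigma>' where \<sigma>': "sorted_subst \<Omega>' \<sigma>'" "map \<sigma>' xs = ts" "\<forall>y. y \<notin> set xs \<longrightarrow> \<sigma>' y = \<sigma> y"
    using subst_extend[OF xs(2) _ \<sigma>] ss(2) xs(1) by blast
  let ?\<tau> = "Var(x := Fun f (map Var xs))"
  have *: "v \<cdot> ?\<tau> \<cdot> \<sigma>' = v \<cdot> \<sigma>" if "vars_trm v \<subseteq> vars_trm l" for v
    unfolding subst_subst
  proof (rule subst_cong)
    fix y assume "y \<in> vars_trm v"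
    then have "y \<notin> set xs" using that xs(3) by blast
    then show "?\<tau> y \<cdot> \<sigma>' = \<sigma> y" using \<sigma>'(2) spec[OF \<sigma>'(3), of y] f(1) by (simp add: comp_def)
  qed
  have "((l \<cdot> ?\<tau>, r \<cdot> ?\<tau>), p) \<in> T_inst tp \<Omega> \<Pi> ((l, r), p)"
    unfolding T_inst_def prod.case mem_Collect_eq
    by (rule exI[of _ ?\<tau>], rule exI[of _ x], rule exI[of _ f], rule exI[of _ ss],
        rule exI[of _ xs]) (intro conjI refl x ss(1) xs)
  moreover have "redex C\<langle>l \<cdot> \<sigma>\<rangle> C\<langle>r \<cdot> \<sigma>\<rangle> (hole_pos C @ p) ((l \<cdot> ?\<tau>, r \<cdot> ?\<tau>), p)"
    unfolding redex_def prod.case using \<sigma>'(1) *[of l, OF subset_refl] *[of r, OF derivedD(4)[OF d]]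
    by (intro exI[of _ C] exI[of _ \<sigma>']) (simp only: simp_thms)
  ultimately show ?thesis by blast
qed

text \<open>The context and substitution that violate stability may have nothing to do with the
  actual \<open>C\<close> and \<open>\<sigma>\<close>. They decide which transformation applies; the
  actual ones supply the symbol to be added.\<close>

lemma progress:
  assumes d: "derived \<rho>" and red: "redex S T P \<rho>" and S: "S = Fun (tp a) [s]" "ground s" "has_sort \<Omega> s a"
    and nst: "\<not> stable \<Omega>' \<Pi> \<rho>" and nob: "\<not> obsolete \<Omega>' \<Pi> \<rho>"
  shows "\<exists>\<rho>'\<in>T_step tp \<Omega> \<Pi> \<rho>. redex S T P \<rho>'"
proof -
  obtain l r p where \<rho>: "\<rho> = ((l, r), p)" by (metis prod.exhaust)
  note d = d[unfolded \<rho>]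
  from red obtain C \<sigma> where C: "sorted_subst \<Omega>' \<sigma>" "hole_pos C @ p = P" "S = C\<langle>l \<cdot> \<sigma>\<rangle>" "T = C\<langle>r \<cdot> \<sigma>\<rangle>"
    by (auto simp: redex_def \<rho>)
  have sS: "has_sort \<Omega>' S a" using S ext_sort by (auto simp: has_sort_Fun ext_sig_tp)
  from nst obtain C' \<sigma>' q' u k \<theta> where N: "(u, k, Here) \<in> \<Pi>" "sorted_subst \<Omega>' \<sigma>'" "sorted_subst \<Omega>' \<theta>"
    "q' \<in> poss C'\<langle>l \<cdot> \<sigma>'\<rangle>" "C'\<langle>l \<cdot> \<sigma>'\<rangle> |_ q' = u \<cdot> \<theta>" "hole_pos C' @ p = q' @ k"
    by (auto simp: stable_def \<rho>)
  obtain \<eta> \<delta> where \<eta>: "variant_apart l u (u \<cdot> (\<lambda>x. Var (\<eta> x)))" "inj \<eta>" "\<forall>x. snd (\<eta> x) = snd x"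
    and \<delta>: "sorted_subst \<Omega>' \<delta>" "\<And>v. v \<cdot> (\<lambda>x. Var (\<eta> x)) \<cdot> \<delta> = v \<cdot> \<theta>"
      "\<And>x. x \<in> vars_trm l \<Longrightarrow> \<delta> x = \<sigma>' x"
    using variant_unifier[OF N(2,3), of l u] by blast
  let ?r = "\<lambda>x. Var (\<eta> x)"
  have pu: "k \<in> poss u" using patternD(2)[OF N(1)] .
  obtain b where su: "has_sort \<Omega> u b" using patternD(3)[OF N(1)] by blast
  \<comment> \<open>The pattern starts at or below the root of the left-hand side, which leads to an
    instantiation, or strictly above it, which leads to an extension.\<close>
  from N(6) consider (inside) q1 where "q' = hole_pos C' @ q1" "p = q1 @ k"
    | (above) q2 where "q2 \<noteq> []" "hole_pos C' = q' @ q2" "k = q2 @ p"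
    unfolding append_eq_append_conv2 by (metis append_Nil2 append_Nil)
  then show ?thesis
  proof cases
    case above
    have q2: "q2 \<in> poss u" "p \<in> poss (u |_ q2)" using pu above(3) by (auto simp: poss_append)
    have "C'\<langle>l \<cdot> \<sigma>'\<rangle> |_ (q' @ q2) = l \<cdot> \<sigma>'"
      using hole_pos_subt_at[of C' "l \<cdot> \<sigma>'" "[]"] above(2) by simp
    then have "(u \<cdot> \<theta>) |_ q2 = l \<cdot> \<sigma>'" using N(5) subt_at_append[OF N(4)] by simp
    then have eq: "(u |_ q2) \<cdot> \<theta> = l \<cdot> \<sigma>'" using subt_at_subst[OF q2(1), of \<theta>] by simp
    \<comment> \<open>With an empty context the root of \<open>l\<close> would be a top symbol. Then
      \<open>p\<close> is not empty, so \<open>u |_ q2\<close> is no variable and its root would be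
      a top symbol too, which no pattern contains.\<close>
    have "C \<noteq> Hole"
    proof
      assume "C = Hole"
      then have "l \<cdot> \<sigma> = Fun (tp a) [s]" using C(3) S(1) by simp
      then obtain ts where l: "l = Fun (tp a) ts" using derivedD(3)[OF d] by (cases l) auto
      have "p \<noteq> []" using derivedD(6)[OF d] l tp_fresh by auto
      then obtain g us where g: "u |_ q2 = Fun g us" using q2(2) by (cases "u |_ q2") auto
      then have "g = tp a" using eq l by simp
      moreover have "g \<in> dom \<Omega>" using has_sort_subt_at[OF su q2(1)] g by (auto simp: has_sort_Fun)
      ultimately show False using tp_fresh by auto
    qed
    moreover have "((u \<cdot> ?r) |_ q2) \<cdot> \<delta> = l \<cdot> \<delta>"
      using subt_at_subst[OF q2(1), of ?r] \<delta>(2) eq subst_cong[of l \<delta> \<sigma>', OF \<delta>(3)] by simp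
    moreover have "q2 \<in> poss (u \<cdot> ?r)" using q2(1) by (simp add: poss_rename)
    ultimately show ?thesis
      using T_ext_progress[OF d C(1) _ _ N(1) \<eta>(1) _ above(1) \<delta>(1) _ above(3), of C a] sS C
      unfolding T_step_def \<rho> by blast
  next
    case inside
    have q1: "q1 \<in> poss l" using derivedD(1)[OF d] inside(2) by (simp add: poss_append)
    have "(l |_ q1) \<cdot> \<sigma>' = u \<cdot> \<theta>"
      using N(5) inside(1) hole_pos_subt_at[of C' "l \<cdot> \<sigma>'" q1] subt_at_subst[OF q1, of \<sigma>'] by simp
    moreover have "(l |_ q1) \<cdot> \<delta> = (l |_ q1) \<cdot> \<sigma>'"
      using \<delta>(3) vars_subt_at[OF q1] by (intro subst_cong) blast
    ultimately have eq: "(u \<cdot> ?r) \<cdot> \<delta> = (l |_ q1) \<cdot> \<delta>" using \<delta>(2) by simp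
    have su': "has_sort \<Omega>' (u \<cdot> ?r) b" using has_sort_rename[OF \<eta>(3)] ext_sort[OF su] .
    obtain a' where sl: "has_sort \<Omega>' l a'" using derivedD(5)[OF d] by blast
    obtain c where sq: "has_sort \<Omega>' (l |_ q1) c" using has_sort_subt_at[OF sl q1] by blast
    have "b = c"
      using has_sort_unique[OF has_sort_subst[OF su' \<delta>(1)]] has_sort_subst[OF sq \<delta>(1)] eq by simp
    note sq = sq[folded this]
    obtain \<mu> where \<mu>: "is_mgu \<Omega>' \<mu> (u \<cdot> ?r) (l |_ q1)" using mgu_exists[OF su' sq eq] by blast
    have "\<exists>x\<in>vars_trm (l |_ q1). \<mu> x \<notin> range Var"
    proof (rule ccontr)
      assume no: "\<not> ?thesis"
      have "u \<cdot> ?r \<cdot> \<mu> = (l |_ q1) \<cdot> \<mu>" using \<mu> by (simp add: is_mgu_def)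
      from linear_match_if_unifiable[OF linear_rename[OF patternD(1)[OF N(1)] \<eta>(2)] this]
      obtain \<tau> where "l |_ q1 = u \<cdot> ?r \<cdot> \<tau>" using no by blast
      then have *: "l |_ q1 = u \<cdot> (\<lambda>x. ?r x \<cdot> \<tau>)" by (simp add: subst_subst)
      \<comment> \<open>Sortedness of the bindings can be read off only for the variables of
        \<open>u\<close>.\<close>
      let ?\<tau> = "\<lambda>x. if x \<in> vars_trm u then ?r x \<cdot> \<tau> else Var x"
      have "sorted_subst \<Omega>' ?\<tau>"
        using sorted_subst_restrict[OF ext_sort[OF su], of \<Omega>' "\<lambda>x. ?r x \<cdot> \<tau>"] sq * by simp
      moreover have "l |_ q1 = u \<cdot> ?\<tau>" unfolding * by (rule subst_cong) simp
      ultimately have "obsolete \<Omega>' \<Pi> \<rho>"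
        unfolding obsolete_def \<rho> using N(1) q1 inside(2) by blast
      with nob show False ..
    qed
    then obtain x where x: "x \<in> vars_trm (l |_ q1)" "\<mu> x \<notin> range Var" by blast
    have xl: "x \<in> vars_trm l" using x(1) vars_subt_at[OF q1] by blast
    have "x \<in> RV \<Omega>' \<Pi> l p"
      unfolding RV_def using xl x(2) \<mu> N(1) \<eta>(1) q1 inside(2) by blast
    moreover obtain f ts where f: "\<sigma> x = Fun f ts" "f \<in> dom \<Omega>"
    proof -
      have "vars_trm (\<sigma> x) \<subseteq> vars_trm (l \<cdot> \<sigma>)" using xl by (auto simp: vars_subst)
      moreover obtain V where "\<forall>t. vars_trm C\<langle>t\<rangle> = V \<union> vars_trm t" using vars_ctxt[of C] by blast
      moreover have "vars_trm S = {}" using S(1,2) by (simp add: ground_def)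
      ultimately have "vars_trm (\<sigma> x) = {}" using C(3) by auto
      then obtain f ts where f: "\<sigma> x = Fun f ts" by (cases "\<sigma> x") auto
      \<comment> \<open>\<open>T_inst\<close> inserts only original symbols. The top symbol of
        \<open>S\<close> never reaches \<open>\<sigma> x\<close>: it is consumed by
        \<open>l\<close>, which is not a variable, or it is the outermost layer of
        \<open>C\<close>.\<close>
      have "funs_trm (\<sigma> x) \<subseteq> funs_trm s"
      proof (cases C)
        case Hole
        then have "l \<cdot> \<sigma> = Fun (tp a) [s]" using C(3) S(1) by simp
        then obtain l' where "l = Fun (tp a) [l']" "l' \<cdot> \<sigma> = s" using derivedD(3)[OF d] by (cases l) auto
        then show ?thesis using funs_subst[of x l' \<sigma>] xl by simp
      next
        case (More g us E vs)
        then have "E\<langle>l \<cdot> \<sigma>\<rangle> = s" using C(3) S(1) by (cases us) auto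
        then show ?thesis using funs_subst[OF xl, of \<sigma>] funs_ctxt[of "l \<cdot> \<sigma>" E] by blast
      qed
      then have "f \<in> dom \<Omega>" using has_sort_funs[OF S(3)] f by auto
      with f that show ?thesis by blast
    qed
    ultimately show ?thesis
      using T_inst_progress[OF d C(1) _ f, of C] C unfolding T_step_def \<rho> by blast
  qed
qed

section \<open>Simulation in both directions\<close>

text \<open>At the added root the pattern would need the non-empty position \<open>0 # P\<close>,
  hence a function symbol at its root, and that symbol is original. Every match therefore lies in
  \<open>s\<close>, and dropping the leading 0 gives a match that forbids the step.\<close>

lemma pattern_below_top:
  assumes u: "(u, k, Here) \<in> \<Pi>" and s: "has_sort \<Omega> s a" and \<theta>: "sorted_subst \<Omega>' \<theta>"
    and q: "q \<in> poss (Fun (tp a) [s])" "Fun (tp a) [s] |_ q = u \<cdot> \<theta>" "q @ k = 0 # P"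
  shows "\<exists>C \<theta>'. sorted_subst \<Omega> \<theta>' \<and> s = C\<langle>u \<cdot> \<theta>'\<rangle> \<and> P = hole_pos C @ k"
proof -
  obtain b where b: "has_sort \<Omega> u b" using patternD(3)[OF u] by blast
  show ?thesis
  proof (cases q)
    case Nil
    then obtain g us where g: "u = Fun g us" using patternD(2)[OF u] q(3) by (cases u) auto
    then have "g = tp a" using q(2) Nil by simp
    moreover have "g \<in> dom \<Omega>" using b g by (auto simp: has_sort_Fun)
    ultimately show ?thesis using tp_fresh by blast
  next
    case (Cons i q')
    then have q': "q' \<in> poss s" "s |_ q' = u \<cdot> \<theta>" "q' @ k = P" using q by auto
    obtain C where C: "s = C\<langle>u \<cdot> \<theta>\<rangle>" "hole_pos C = q'" using ctxt_of_pos[OF q'(1)] q'(2) by auto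
    obtain c where "has_sort \<Omega> (u \<cdot> \<theta>) c" using has_sort_ctxt_hole[OF s[unfolded C(1)]] by blast
    from match_restrict[OF b this \<theta>] obtain \<theta>' where
      "sorted_subst \<Omega> \<theta>'" "\<forall>x\<in>vars_trm u. \<theta>' x = \<theta> x" by blast
    moreover from this have "u \<cdot> \<theta>' = u \<cdot> \<theta>" by (blast intro: subst_cong)
    ultimately show ?thesis using C q'(3) by metis
  qed
qed

lemma step_preserves:
  assumes "(l, r) \<in> R" "sorted_subst \<Omega> \<sigma>" "ground C\<langle>l \<cdot> \<sigma>\<rangle>" "has_sort \<Omega> C\<langle>l \<cdot> \<sigma>\<rangle> a"
  shows "ground C\<langle>r \<cdot> \<sigma>\<rangle>" "has_sort \<Omega> C\<langle>r \<cdot> \<sigma>\<rangle> a"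
proof -
  obtain V where "\<forall>t. vars_trm C\<langle>t\<rangle> = V \<union> vars_trm t" using vars_ctxt[of C] by blast
  then show "ground C\<langle>r \<cdot> \<sigma>\<rangle>"
    using assms(3) ruleD(3)[OF assms(1)] by (auto simp: ground_def vars_subst)
  show "has_sort \<Omega> C\<langle>r \<cdot> \<sigma>\<rangle> a"
    using ruleD(1)[OF assms(1)] has_sort_ctxt_replace[OF assms(4)] has_sort_subst[OF _ assms(2)] by blast
qed

lemma fp_step_simulated:
  assumes "fp_step (\<Omega>, R) \<Pi> s t" and s: "ground s" "has_sort \<Omega> s a"
  shows "rstep (transform tp (\<Omega>, R) \<Pi>) (Fun (tp a) [s]) (Fun (tp a) [t])" "ground t" "has_sort \<Omega> t a"
proof -
  let ?S = "Fun (tp a) [s]" and ?T = "Fun (tp a) [t]"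
  from assms(1) obtain l r C \<sigma> P where lr: "(l, r) \<in> R" "sorted_subst \<Omega> \<sigma>" "hole_pos C = P"
    "s = C\<langle>l \<cdot> \<sigma>\<rangle>" "t = C\<langle>r \<cdot> \<sigma>\<rangle>"
    and allowed: "\<not> (\<exists>u k C q' \<sigma>. (u, k, Here) \<in> \<Pi> \<and> sorted_subst \<Omega> \<sigma> \<and>
          hole_pos C = q' \<and> s = C\<langle>u \<cdot> \<sigma>\<rangle> \<and> P = q' @ k)"
    unfolding fp_step_def rstep_at_iff fst_conv by blast
  show "ground t" "has_sort \<Omega> t a" using step_preserves[OF lr(1,2)] s lr(4,5) by auto
  have nob: "\<not> obsolete \<Omega>' \<Pi> \<rho>" if red: "redex ?S ?T (0 # P) \<rho>" for \<rho>
  proof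
    assume ob: "obsolete \<Omega>' \<Pi> \<rho>"
    obtain l' r' p where \<rho>: "\<rho> = ((l', r'), p)" by (metis prod.exhaust)
    from ob obtain u k q \<theta> where u: "(u, k, Here) \<in> \<Pi>" "sorted_subst \<Omega>' \<theta>" "q \<in> poss l'"
      "l' |_ q = u \<cdot> \<theta>" "p = q @ k" by (auto simp: obsolete_def \<rho>)
    from red obtain E \<tau> where E: "sorted_subst \<Omega>' \<tau>" "hole_pos E @ p = 0 # P" "?S = E\<langle>l' \<cdot> \<tau>\<rangle>"
      by (auto simp: redex_def \<rho>)
    have "hole_pos E @ q \<in> poss ?S" "?S |_ (hole_pos E @ q) = u \<cdot> (\<lambda>x. \<theta> x \<cdot> \<tau>)"
      unfolding E(3) hole_pos_poss hole_pos_subt_at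
      using subt_at_subst[OF u(3), of \<tau>] u(4) by (auto simp: subst_subst)
    from pattern_below_top[OF u(1) s(2) sorted_subst_comp[OF u(2) E(1)] this, of P] E(2) u(5)
    show False using allowed u(1) by auto
  qed
  \<comment> \<open>In every round the redex is served by an accepted or a pending rule; once
    nothing is pending, the accepted one remains.\<close>
  have inv: "(\<exists>\<rho>\<in>snd (loop_state n). redex ?S ?T (0 # P) \<rho>) \<or>
      (\<exists>\<rho>\<in>fst (loop_state n). redex ?S ?T (0 # P) \<rho>)" for n
  proof (induction n)
    case 0
    have "redex ?S ?T (0 # P) ((l, r), [])"
      unfolding redex_def using lr ext_subst
      by (auto intro!: exI[of _ "More (tp a) [] C []"] exI[of _ \<sigma>])
    then show ?case using lr(1) by (auto simp: loop_state_0)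
  next
    case (Suc n)
    then show ?case
    proof
      assume "\<exists>\<rho>\<in>fst (loop_state n). redex ?S ?T (0 # P) \<rho>"
      then obtain \<rho> where \<rho>: "\<rho> \<in> fst (loop_state n)" "redex ?S ?T (0 # P) \<rho>" by blast
      show ?thesis
      proof (cases "stable \<Omega>' \<Pi> \<rho>")
        case True
        then show ?thesis using \<rho> by (auto simp: snd_loop_state_Suc)
      next
        case False
        from progress[OF derived_loop_state[OF \<rho>(1)] \<rho>(2) refl s False nob[OF \<rho>(2)]]
        show ?thesis using \<rho>(1) False nob[OF \<rho>(2)] unfolding fst_loop_state_Suc by blast
      qed
    qed (auto simp: snd_loop_state_Suc)
  qed
  obtain n where n: "fst (loop_state n) = {}" "transform_loop tp (\<Omega>, R) \<Pi> = loop_state n"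
    using transform_loop_eq by blast
  with inv[of n] obtain l' r' p where acc: "((l', r'), p) \<in> snd (loop_state n)"
    "redex ?S ?T (0 # P) ((l', r'), p)" by auto
  then have lr': "(l', r') \<in> fst ` snd (transform_loop tp (\<Omega>, R) \<Pi>)" using n(2) by force
  from acc(2) obtain D \<tau> where "sorted_subst \<Omega>' \<tau>" "?S = D\<langle>l' \<cdot> \<tau>\<rangle>" "?T = D\<langle>r' \<cdot> \<tau>\<rangle>"
    unfolding redex_def prod.case by blast
  with lr' show "rstep (transform tp (\<Omega>, R) \<Pi>) ?S ?T"
    unfolding transform_def rstep_iff fst_conv by blast
qed

lemma fp_step_reflected:
  assumes "rstep (transform tp (\<Omega>, R) \<Pi>) (Fun (tp a) [s]) T" and s: "ground s" "has_sort \<Omega> s a"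
  shows "\<exists>t. T = Fun (tp a) [t] \<and> fp_step (\<Omega>, R) \<Pi> s t \<and> ground t \<and> has_sort \<Omega> t a"
proof -
  let ?S = "Fun (tp a) [s]"
  obtain n where n: "transform_loop tp (\<Omega>, R) \<Pi> = loop_state n" using transform_loop_eq by blast
  from assms(1) obtain l r C \<sigma> where "(l, r) \<in> fst ` snd (loop_state n)"
    and C: "sorted_subst \<Omega>' \<sigma>" "?S = C\<langle>l \<cdot> \<sigma>\<rangle>" "T = C\<langle>r \<cdot> \<sigma>\<rangle>"
    unfolding transform_def rstep_iff fst_conv n by blast
  then obtain p where acc: "((l, r), p) \<in> snd (loop_state n)" by auto
  have d: "derived ((l, r), p)" and st: "stable \<Omega>' \<Pi> ((l, r), p)" using accepted[OF acc] by auto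
  from d obtain l0 r0 D \<tau> where lr: "(l0, r0) \<in> R" "sorted_subst \<Omega>' \<tau>" "hole_pos D = p"
    "l = D\<langle>l0 \<cdot> \<tau>\<rangle>" "r = D\<langle>r0 \<cdot> \<tau>\<rangle>" by (auto simp: derived_def)
  obtain D' where D': "hole_pos D' = p" "\<forall>t. D\<langle>t\<rangle> \<cdot> \<sigma> = D'\<langle>t \<cdot> \<sigma>\<rangle>"
    using ctxt_subst[of D \<sigma>] lr(3) by auto
  obtain E where E: "hole_pos E = hole_pos C @ p" "\<forall>t. C\<langle>D'\<langle>t\<rangle>\<rangle> = E\<langle>t\<rangle>"
    using ctxt_comp[of C D'] D'(1) by auto
  let ?\<sigma> = "\<lambda>x. \<tau> x \<cdot> \<sigma>"
  have ST: "?S = E\<langle>l0 \<cdot> ?\<sigma>\<rangle>" "T = E\<langle>r0 \<cdot> ?\<sigma>\<rangle>"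
    using C(2,3) lr(4,5) D'(2) E(2) by (simp_all add: subst_subst)
  obtain f ts where l0: "l0 = Fun f ts" using ruleD(2)[OF lr(1)] by (cases l0) auto
  obtain b where b: "has_sort \<Omega> l0 b" using ruleD(1)[OF lr(1)] by blast
  \<comment> \<open>The root of \<open>l0\<close> is an original symbol, so the redex cannot sit at
    the added root, and peeling the top symbol off \<open>E\<close> leaves a context in
    \<open>s\<close>.\<close>
  have "f \<noteq> tp a" using b l0 tp_fresh by (auto simp: has_sort_Fun)
  then obtain E' where E': "E = More (tp a) [] E' []" "s = E'\<langle>l0 \<cdot> ?\<sigma>\<rangle>"
    using ST(1) l0 by (cases E) (auto simp: Cons_eq_append_conv)
  obtain c where "has_sort \<Omega> (l0 \<cdot> ?\<sigma>) c" using has_sort_ctxt_hole[OF s(2)[unfolded E'(2)]] by blast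
  from match_restrict[OF b this sorted_subst_comp[OF lr(2) C(1)]] obtain \<sigma>' where
    \<sigma>': "sorted_subst \<Omega> \<sigma>'" "\<forall>x\<in>vars_trm l0. \<sigma>' x = ?\<sigma> x" by blast
  have eq: "l0 \<cdot> ?\<sigma> = l0 \<cdot> \<sigma>'" "r0 \<cdot> ?\<sigma> = r0 \<cdot> \<sigma>'"
    using \<sigma>'(2) ruleD(3)[OF lr(1)] by (auto intro!: subst_cong)
  define t where "t = E'\<langle>r0 \<cdot> \<sigma>'\<rangle>"
  have s_eq: "s = E'\<langle>l0 \<cdot> \<sigma>'\<rangle>" using E'(2) eq(1) by simp
  let ?P = "hole_pos E'"
  have P: "?P \<in> poss s" "s |_ ?P = l0 \<cdot> \<sigma>'"
    using hole_pos_poss[of E' "[]"] hole_pos_subt_at[of E' _ "[]"] unfolding s_eq by auto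
  have "\<not> ((u, k, Here) \<in> \<Pi> \<and> sorted_subst \<Omega> \<theta> \<and> s = F\<langle>u \<cdot> \<theta>\<rangle> \<and> ?P = hole_pos F @ k)" for u k \<theta> F
  proof
    assume u: "(u, k, Here) \<in> \<Pi> \<and> sorted_subst \<Omega> \<theta> \<and> s = F\<langle>u \<cdot> \<theta>\<rangle> \<and> ?P = hole_pos F @ k"
    \<comment> \<open>The leading 0 selects the argument of the top symbol; it turns an occurrence
      in \<open>s\<close> into one that the stability of the accepted rule excludes.\<close>
    have "0 # hole_pos F \<in> poss ?S" "?S |_ (0 # hole_pos F) = u \<cdot> \<theta>"
      using u hole_pos_poss[of F "[]"] hole_pos_subt_at[of F _ "[]"] by auto
    moreover have "hole_pos C @ p = (0 # hole_pos F) @ k" using E(1) E'(1) u by simp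
    moreover have "\<exists>a. has_sort \<Omega>' ?S a" using s(2) ext_sort by (auto simp: has_sort_Fun ext_sig_tp)
    moreover have "sorted_subst \<Omega>' \<theta>" using u ext_subst by blast
    ultimately show False using st u C(1) unfolding stable_def C(2) by blast
  qed
  moreover have "?P \<in> fun_poss s" using P l0 by (auto simp: fun_poss_def)
  moreover have "rstep_at (\<Omega>, R) ?P s t"
    unfolding rstep_at_iff using lr(1) \<sigma>'(1) s_eq t_def by blast
  ultimately have "fp_step (\<Omega>, R) \<Pi> s t" unfolding fp_step_def fst_conv by blast
  moreover have "T = Fun (tp a) [t]" using ST(2) E'(1) eq(2) by (simp add: t_def)
  ultimately show ?thesis
    using step_preserves[OF lr(1) \<sigma>'(1), of E' a] s unfolding s_eq[symmetric] t_def[symmetric] by blast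
qed

lemma fp_steps_iff:
  assumes "ground s" "has_sort \<Omega> s a"
  shows "(fp_step (\<Omega>, R) \<Pi>)\<^sup>+\<^sup>+ s t \<longleftrightarrow>
    (rstep (transform tp (\<Omega>, R) \<Pi>))\<^sup>+\<^sup>+ (Fun (tp a) [s]) (Fun (tp a) [t])"
proof
  assume "(fp_step (\<Omega>, R) \<Pi>)\<^sup>+\<^sup>+ s t"
  then show "(rstep (transform tp (\<Omega>, R) \<Pi>))\<^sup>+\<^sup>+ (Fun (tp a) [s]) (Fun (tp a) [t])"
    using assms
  proof (induction rule: converse_tranclp_induct)
    case (base s)
    then show ?case by (blast intro: fp_step_simulated)
  next
    case (step s s')
    from fp_step_simulated[OF step.hyps(1) step.prems] step.IH show ?case
      by (blast intro: tranclp_into_tranclp2)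
  qed
next
  \<comment> \<open>The end term is generalised to an arbitrary \<open>T\<close>, since the
    induction must also show that every intermediate term carries the top symbol and stays ground
    and sorted.\<close>
  have "\<exists>t. T = Fun (tp a) [t] \<and> (fp_step (\<Omega>, R) \<Pi>)\<^sup>+\<^sup>+ s t \<and> ground t \<and> has_sort \<Omega> t a"
    if "(rstep (transform tp (\<Omega>, R) \<Pi>))\<^sup>+\<^sup>+ (Fun (tp a) [s]) T" for T
    using that
  proof (induction rule: tranclp_induct)
    case (base T)
    then show ?case using fp_step_reflected[OF base assms] by blast
  next
    case (step T U)
    then obtain t where t: "T = Fun (tp a) [t]" "(fp_step (\<Omega>, R) \<Pi>)\<^sup>+\<^sup>+ s t" "ground t" "has_sort \<Omega> t a"
      by blast
    with fp_step_reflected[OF step.hyps(2)[unfolded t(1)] t(3,4)] show ?case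
      by (blast intro: tranclp.trancl_into_trancl)
  qed
  then show "(fp_step (\<Omega>, R) \<Pi>)\<^sup>+\<^sup>+ s t"
    if "(rstep (transform tp (\<Omega>, R) \<Pi>))\<^sup>+\<^sup>+ (Fun (tp a) [s]) (Fun (tp a) [t])"
    using that by blast
qed

end

theorem theorem25:
  fixes \<Omega> :: "('f, 's::finite) signature"
    and R :: "('f, 's) rule set"
    and \<Pi> :: "('f, 's) pattern set"
    and tp :: "'s \<Rightarrow> 'f"
    and s t :: "('f, 's) sterm"
    and a b :: 's
  assumes "finite (dom \<Omega>)"
    and "is_trs (\<Omega>, R)"
    and "inj tp" and "range tp \<inter> dom \<Omega> = {}"
    and "finite \<Pi>" and "\<forall>\<pi>\<in>\<Pi>. is_pattern \<Omega> \<pi>"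
    and "\<forall>(u, k, h)\<in>\<Pi>. h = Here \<and> linear_trm u"
    and "ground s" and "has_sort \<Omega> s a"
    and "ground t" and "has_sort \<Omega> t b"
  shows "(fp_step (\<Omega>, R) \<Pi>)\<^sup>+\<^sup>+ s t \<longleftrightarrow>
    (rstep (transform tp (\<Omega>, R) \<Pi>))\<^sup>+\<^sup>+ (Fun (tp a) [s]) (Fun (tp a) [t])"
proof -
  interpret forbidden_patterns \<Omega> R \<Pi> tp
    using assms by unfold_locales
  show ?thesis using assms(8,9) by (rule fp_steps_iff)
qed

end
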